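(* Let $\Omega\subset\mathbb{C}^n$ be a bounded starlike circular domain containing $0$ whose Minkowski functional $\rho$ is $C^1$ except on some lower-dimensional manifolds $E\subset\mathbb{C}^n$. Let $k\geq 1$ be an integer, let $f:\Omega\to\mathbb{C}$ be holomorphic, and suppose that the mapping $F(z)=z f(z)$ belongs to $\mathcal{S}^*(\Omega)$. For $z\in\Omega\setminus E$ put $$ a_{2k+1}=2\frac{\partial\rho(z)}{\partial z}\frac{D^{2k+1}F(0)(z^{2k+1})}{(2k+1)!\,\rho^{2k+1}(z)},\qquad a_{k+1}=2\frac{\partial\rho(z)}{\partial z}\frac{D^{k+1}F(0)(z^{k+1})}{(k+1)!\,\rho^{k+1}(z)}. $$ If $F(z)-z$ has a zero of order $k+1$ at $z=0$, then for every $z\in\Omega\setminus E$, $$ \left\vert 1 - a_{2k+1}^2 - 2a_{k+1}^2 + 2a_{k+1}^2 a_{2k+1} \right\vert \leq \begin{cases} 1+\dfrac{8}{k^2}+\dfrac{(k+2)(6-k)}{k^4}, & 1\leq k\leq 3,\\[2mm] 1+\dfrac{8}{k^2}+\dfrac{2+k}{k^3}, & k\geq 3. \end{cases} $$ The bound is sharp for $k=1,2,3$: for every such $\Omega$ and each $k\in\{1,2,3\}$, the right-hand side cannot be replaced by any smaller constant (valid for all $F$ satisfying the hypotheses and all $z\in\Omega\setminus E$).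
   Context: A bounded starlike circular domain $\Omega\subset\mathbb{C}^n$ is a bounded domain for which there is a (unique) continuous function $\rho:\mathbb{C}^n\to\mathbb{R}$, its Minkowski functional, with $\rho(z)\ge0$ and $\rho(z)=0\Leftrightarrow z=0$; $\rho(tz)=|t|\rho(z)$ for $t\in\mathbb{C}$, $z\in\mathbb{C}^n$; and $\Omega=\{z\in\mathbb{C}^n:\rho(z)<1\}$. "$\rho$ is $C^1$ except on lower-dimensional manifolds $E$" means that $\rho$ is continuously differentiable on $\mathbb{C}^n\setminus E$, where $E$ consists of manifolds of real dimension less than $2n$ (necessarily $0\in E$). Write $\frac{\partial\rho(z)}{\partial z}=\left(\frac{\partial\rho(z)}{\partial z_1},\dots,\frac{\partial\rho(z)}{\partial z_n}\right)$ (Wirtinger derivatives, a row vector, multiplied with column vectors of $\mathbb{C}^n$), and $\rho^m(z)=(\rho(z))^m$. For holomorphic $F:\Omega\to\mathbb{C}^n$, $D^mF(0)$ is the $m$-th Fréchet derivative at $0$ (a symmetric $m$-linear mapping) and $D^mF(0)(z^m)=D^mF(0)(z,\dots,z)$ ($m$ times). $F$ is normalized if $F(0)=0$ and $DF(0)=I$, and locally biholomorphic if $DF(z)$ is invertible for each $z\in\Omega$. The class $\mathcal{S}^*(\Omega)$ of starlike mappings on $\Omega$ consists of all normalized locally biholomorphic $F:\Omega\to\mathbb{C}^n$ such that $\operatorname{Re}\left(\frac{\partial\rho(z)}{\partial z}(DF(z))^{-1}F(z)\right)>0$ for all $z\in\Omega\setminus E$. A holomorphic mapping $g:\Omega\to\mathbb{C}^n$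 has a zero of order $m$ at $z=0$ ($m\in\mathbb{N}$) if $g(0)=0$, $Dg(0)=0,\dots,D^{m-1}g(0)=0$ and $D^mg(0)\neq0$. *)

theory Defs
  imports "HOL-Analysis.Analysis"
begin

definition minkowski_functional :: "(complex ^ 'n \<Rightarrow> real) \<Rightarrow> (complex ^ 'n) set \<Rightarrow> bool" where
  "minkowski_functional \<rho> \<Omega> \<longleftrightarrow>
     continuous_on UNIV \<rho> \<and>
     (\<forall>z. \<rho> z \<ge> 0) \<and> (\<forall>z. \<rho> z = 0 \<longleftrightarrow> z = 0) \<and>
     (\<forall>t z. \<rho> (t *s z) = cmod t * \<rho> z) \<and>
     \<Omega> = {z. \<rho> z < 1}"

definition bounded_starlike_circular_domain :: "(complex ^ 'n) set \<Rightarrow> bool" where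
  "bounded_starlike_circular_domain \<Omega> \<longleftrightarrow>
     bounded \<Omega> \<and> open \<Omega> \<and> connected \<Omega> \<and> \<Omega> \<noteq> {} \<and> (\<exists>\<rho>. minkowski_functional \<rho> \<Omega>)"

text \<open>
  A subset with its subspace topology is automatically Hausdorff and second countable, so only
  the charts have to be required. No smoothness is demanded; in particular all \<open>C\<^sup>1\<close>
  submanifolds are included. The exceptional set may consist of countably many such pieces and
  need not be closed.
\<close>

definition topological_submanifold :: "nat \<Rightarrow> 'a::euclidean_space set \<Rightarrow> bool" where
  "topological_submanifold d M \<longleftrightarrow>
     (\<forall>x\<in>M. \<exists>U. openin (top_of_set M) U \<and> x \<in> U \<and>
                top_of_set U homeomorphic_space Euclidean_space d)"

definition consists_of_lower_dim_manifolds :: "(complex ^ 'n) set \<Rightarrow> bool" where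
  "consists_of_lower_dim_manifolds E \<longleftrightarrow>
     (\<exists>\<M>. countable \<M> \<and> E = \<Union>\<M> \<and>
          (\<forall>M\<in>\<M>. \<exists>d < 2 * CARD('n). topological_submanifold d M))"

definition C1_outside :: "(complex ^ 'n \<Rightarrow> real) \<Rightarrow> (complex ^ 'n) set \<Rightarrow> bool" where
  "C1_outside \<rho> E \<longleftrightarrow>
     (\<exists>\<rho>' :: complex ^ 'n \<Rightarrow> ((complex ^ 'n) \<Rightarrow>\<^sub>L real).
        (\<forall>z\<in>- E. (\<rho> has_derivative blinfun_apply (\<rho>' z)) (at z)) \<and>
        continuous_on (- E) \<rho>')"

text \<open>
  The row vector of Wirtinger derivatives
  \<open>\<partial>/\<partial>z\<^sub>j = (\<partial>/\<partial>x\<^sub>j - \<i> \<partial>/\<partial>y\<^sub>j) / 2\<close> for \<open>z\<^sub>j = x\<^sub>j + \<i> y\<^sub>j\<close>.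
  It is multiplied with column vectors by \<open>scalar_product\<close>, which does not conjugate.
\<close>

definition wirtinger :: "(complex ^ 'n \<Rightarrow> real) \<Rightarrow> complex ^ 'n \<Rightarrow> complex ^ 'n" where
  "wirtinger \<rho> z = (\<chi> j.
     (of_real (deriv (\<lambda>t::real. \<rho> (z + t *\<^sub>R axis j 1)) 0)
      - \<i> * of_real (deriv (\<lambda>t::real. \<rho> (z + t *\<^sub>R axis j \<i>)) 0)) / 2)"

text \<open>
  Holomorphy is complex Frechet differentiability: \<open>has_derivative\<close> only asks for real
  linearity, so complex linearity of the derivative is required separately.
\<close>

definition holomorphic_fun_on :: "(complex ^ 'n \<Rightarrow> complex) \<Rightarrow> (complex ^ 'n) set \<Rightarrow> bool" where
  "holomorphic_fun_on f S \<longleftrightarrow>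
     (\<forall>z\<in>S. \<exists>A. (f has_derivative A) (at z) \<and> Vector_Spaces.linear (*s) (*) A)"

definition holomorphic_map_on :: "(complex ^ 'n \<Rightarrow> complex ^ 'n) \<Rightarrow> (complex ^ 'n) set \<Rightarrow> bool" where
  "holomorphic_map_on F S \<longleftrightarrow>
     (\<forall>z\<in>S. \<exists>A. (F has_derivative A) (at z) \<and> Vector_Spaces.linear (*s) (*s) A)"

definition jacobian :: "(complex ^ 'n \<Rightarrow> complex ^ 'n) \<Rightarrow> complex ^ 'n \<Rightarrow> complex ^ 'n ^ 'n" where
  "jacobian F z = matrix (frechet_derivative F (at z))"

text \<open>
  \<open>higher_frechet F [v\<^sub>1, \<dots>, v\<^sub>m] z\<close> is \<open>D\<^sup>m F(z)(v\<^sub>1, \<dots>, v\<^sub>m)\<close>: the \<open>m\<close>-linear mapping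
  \<open>D\<^sup>m F(z)\<close> is represented by its values on lists of length \<open>m\<close>, which avoids iterated
  spaces of linear mappings.
\<close>

primrec higher_frechet ::
  "('a::real_normed_vector \<Rightarrow> 'b::real_normed_vector) \<Rightarrow> 'a list \<Rightarrow> 'a \<Rightarrow> 'b" where
  "higher_frechet F [] = F"
| "higher_frechet F (v # vs) = (\<lambda>z. frechet_derivative (higher_frechet F vs) (at z) v)"

definition higher_frechet_zero ::
  "('a::real_normed_vector \<Rightarrow> 'b::real_normed_vector) \<Rightarrow> nat \<Rightarrow> 'a \<Rightarrow> bool" where
  "higher_frechet_zero F m z \<longleftrightarrow> (\<forall>vs. length vs = m \<longrightarrow> higher_frechet F vs z = 0)"

definition zero_of_order :: "(complex ^ 'n \<Rightarrow> complex ^ 'n) \<Rightarrow> nat \<Rightarrow> bool" where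
  "zero_of_order g m \<longleftrightarrow>
     g 0 = 0 \<and> (\<forall>j. 1 \<le> j \<and> j < m \<longrightarrow> higher_frechet_zero g j 0) \<and> \<not> higher_frechet_zero g m 0"

definition normalized :: "(complex ^ 'n \<Rightarrow> complex ^ 'n) \<Rightarrow> bool" where
  "normalized F \<longleftrightarrow> F 0 = 0 \<and> jacobian F 0 = mat 1"

definition locally_biholomorphic_on ::
  "(complex ^ 'n \<Rightarrow> complex ^ 'n) \<Rightarrow> (complex ^ 'n) set \<Rightarrow> bool" where
  "locally_biholomorphic_on F \<Omega> \<longleftrightarrow>
     holomorphic_map_on F \<Omega> \<and> (\<forall>z\<in>\<Omega>. invertible (jacobian F z))"

definition starlike_maps ::
  "(complex ^ 'n) set \<Rightarrow> (complex ^ 'n \<Rightarrow> real) \<Rightarrow> (complex ^ 'n) set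
    \<Rightarrow> (complex ^ 'n \<Rightarrow> complex ^ 'n) set" where
  "starlike_maps \<Omega> \<rho> E = {F. normalized F \<and> locally_biholomorphic_on F \<Omega> \<and>
     (\<forall>z\<in>\<Omega> - E. Re (scalar_product (wirtinger \<rho> z) (matrix_inv (jacobian F z) *v F z)) > 0)}"

text \<open>The quantity \<open>a\<^sub>m = 2 (\<partial>\<rho>(z)/\<partial>z) D\<^sup>m F(0)(z\<^sup>m) / (m! \<rho>(z)\<^sup>m)\<close>.\<close>

definition coeff_a ::
  "(complex ^ 'n \<Rightarrow> real) \<Rightarrow> (complex ^ 'n \<Rightarrow> complex ^ 'n) \<Rightarrow> nat \<Rightarrow> complex ^ 'n \<Rightarrow> complex" where
  "coeff_a \<rho> F m z =
     2 * scalar_product (wirtinger \<rho> z) (higher_frechet F (replicate m z) 0)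
       / (fact m * of_real (\<rho> z ^ m))"

definition toeplitz_quantity ::
  "(complex ^ 'n \<Rightarrow> real) \<Rightarrow> (complex ^ 'n \<Rightarrow> complex ^ 'n) \<Rightarrow> nat \<Rightarrow> complex ^ 'n \<Rightarrow> real" where
  "toeplitz_quantity \<rho> F k z =
     (let a = coeff_a \<rho> F (2 * k + 1) z; b = coeff_a \<rho> F (k + 1) z
      in cmod (1 - a\<^sup>2 - 2 * b\<^sup>2 + 2 * b\<^sup>2 * a))"

definition admissible ::
  "(complex ^ 'n) set \<Rightarrow> (complex ^ 'n \<Rightarrow> real) \<Rightarrow> (complex ^ 'n) set \<Rightarrow> nat
    \<Rightarrow> (complex ^ 'n \<Rightarrow> complex) \<Rightarrow> bool" where
  "admissible \<Omega> \<rho> E k f \<longleftrightarrow>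
     holomorphic_fun_on f \<Omega> \<and>
     (\<lambda>z. f z *s z) \<in> starlike_maps \<Omega> \<rho> E \<and>
     zero_of_order (\<lambda>z. f z *s z - z) (k + 1)"

end

theory Submission
  imports Defs "HOL-Complex_Analysis.Complex_Analysis" "HOL-Homology.Invariance_of_Domain"
begin

text \<open>
  Since \<open>2 (\<partial>\<rho>/\<partial>z) z = \<rho>\<close> off \<open>E\<close>, everything reduces to the slice
  \<open>G(t) = f(t z / \<rho>(z)) = 1 + t\<^sup>k A(t)\<close> on the unit disc: \<open>a\<^bsub>k+1\<^esub>\<close> and \<open>a\<^bsub>2k+1\<^esub>\<close> are the
  coefficients of \<open>t\<^sup>0\<close> and \<open>t\<^sup>k\<close> in \<open>A\<close>, and starlikeness says that \<open>G / (G + t G')\<close> has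
  nonnegative real part. The latter is only assumed off \<open>E\<close>, and a slice may lie inside \<open>E\<close>;
  but the complement of \<open>E\<close> is dense by Baire's theorem and invariance of domain.

  Consequently \<open>t G' / (2 G + t G') = t\<^sup>k \<phi>(t)\<close> with \<open>\<bar>\<phi>\<bar> \<le> 1\<close>, and the coefficients
  \<open>\<tau>\<close> of \<open>t\<^sup>0\<close> and \<open>y\<close> of \<open>t\<^sup>k\<close> in \<open>\<phi>\<close> satisfy \<open>\<bar>y\<bar> \<le> 1 - \<bar>\<tau>\<bar>\<^sup>2\<close>. With \<open>b = a\<^bsub>k+1\<^esub> = 2 \<tau> / k\<close> and
  \<open>a = a\<^bsub>2k+1\<^esub> = y / k + (k + 2) \<tau>\<^sup>2 / k\<^sup>2\<close> the bound follows from
  \<open>1 - a\<^sup>2 - 2 b\<^sup>2 + 2 b\<^sup>2 a = 1 - 2 b\<^sup>2 - a (a - 2 b\<^sup>2)\<close>.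

  For sharpness take \<open>\<tau> = \<i>\<close>, i.e. \<open>f = (1 - \<i> L\<^sup>k)\<close> to the power \<open>-2/k\<close>, where \<open>L\<close> is a linear
  functional with \<open>\<bar>L\<bar> \<le> \<rho>\<close> and equality at some point. That point may lie in \<open>E\<close>, so the value
  is approached by density.
\<close>

subsection \<open>Density of the complement of the exceptional set\<close>

text \<open>Invariance of domain: on \<open>interior K\<close> the homeomorphism is a continuous
  injection into a space of the same dimension, so its image is open; but that image lies in a
  proper subspace, which has empty interior.\<close>

lemma compact_homeomorphic_lowdim_interior:
  fixes K S :: "'a::euclidean_space set"
  assumes "K homeomorphic T" "T \<subseteq> S" "subspace S" "dim S < DIM('a)"
  shows "interior K = {}"
proof -
  obtain g h where gh: "homeomorphism K T g h"
    using assms(1) by (auto simp: homeomorphic_def)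
  have "open (g ` interior K)"
  proof (rule invariance_of_domain)
    show "continuous_on (interior K) g"
      using gh interior_subset by (metis continuous_on_subset homeomorphism_cont1)
    show "inj_on g (interior K)"
      using gh interior_subset[of K] by (intro inj_on_inverseI[of _ h]) (auto simp: homeomorphism_def)
  qed auto
  moreover have "g ` interior K \<subseteq> S"
    using gh interior_subset[of K] assms(2) by (auto simp: homeomorphism_def)
  moreover have "interior S = {}"
    using assms(4) by (simp add: empty_interior_lowdim)
  ultimately have "g ` interior K = {}"
    by (metis interior_maximal subset_empty)
  then show ?thesis by blast
qed

lemma dense_Compl_countable_Union:
  fixes \<K> :: "'a::euclidean_space set set"
  assumes "countable \<K>" and "\<And>K. K \<in> \<K> \<Longrightarrow> closed K \<and> interior K = {}"
  shows "closure (- \<Union>\<K>) = UNIV"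
proof -
  have "UNIV \<subseteq> closure (\<Inter>(uminus ` \<K>))"
    using assms by (intro Baire) (auto simp: closure_complement)
  then show ?thesis
    by (simp add: uminus_Sup top.extremum_unique)
qed

text \<open>Baire's theorem needs closed sets, and a submanifold need not be closed. A chart carries
  the exhaustion of its model space by compact balls over to \<open>M\<close>, and the Lindelof
  property reduces the charts to countably many.\<close>

lemma topological_submanifold_sigma_compact:
  fixes M :: "'a::euclidean_space set"
  assumes "topological_submanifold d M" "d < DIM('a)"
  obtains \<K> where "countable \<K>" "\<Union>\<K> = M" "\<And>K. K \<in> \<K> \<Longrightarrow> compact K \<and> interior K = {}"
proof -
  \<comment> \<open>The model space is a \<open>d\<close>-dimensional subspace of \<open>'a\<close>
    itself, so that invariance of domain compares sets in one ambient space.\<close>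
  obtain S :: "'a set" where S: "subspace S" "dim S = d"
    using choose_subspace_of_subspace[of d "UNIV :: 'a set"] assms(2) by auto
  define \<K>0 where "\<K>0 = {K. K \<subseteq> M \<and> compact K \<and> interior K = {}}"
  have chart: "\<exists>\<K>. countable \<K> \<and> \<Union>\<K> = U \<and> \<K> \<subseteq> \<K>0"
    if U: "openin (top_of_set M) U" "top_of_set U homeomorphic_space Euclidean_space d" for U
  proof -
    have "top_of_set S homeomorphic_space Euclidean_space d"
      using homeomorphic_subspace_Euclidean_space S by blast
    then have "S homeomorphic U"
      using U(2) homeomorphic_space_sym homeomorphic_space_trans
      by (metis homeomorphic_space_iff_homeomorphic)
    then obtain h g where gh: "homeomorphism S U h g"
      by (auto simp: homeomorphic_def)
    define \<K> where "\<K> = range (\<lambda>n::nat. h ` (S \<inter> cball 0 n))"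
    have "S = (\<Union>n::nat. S \<inter> cball 0 n)"
      by (auto simp: real_arch_simple)
    then have "\<Union>\<K> = U"
      using gh unfolding \<K>_def homeomorphism_def by (metis image_UN)
    moreover have "K \<in> \<K>0" if K: "K \<in> \<K>" for K
    proof -
      obtain n :: nat where K: "K = h ` (S \<inter> cball 0 n)"
        using K \<K>_def by auto
      have "compact (S \<inter> cball 0 n)"
        using closed_subspace[OF S(1)] by (simp add: closed_Int_compact)
      then have "compact K"
        unfolding K using gh
        by (meson Int_lower1 compact_continuous_image continuous_on_subset homeomorphism_cont1)
      moreover have "homeomorphism (S \<inter> cball 0 n) K h g"
        using \<open>\<Union>\<K> = U\<close> \<open>K \<in> \<K>\<close> K by (intro homeomorphism_of_subsets[OF gh]) auto
      then have "K homeomorphic (S \<inter> cball 0 n)"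
        using homeomorphic_def homeomorphic_sym by blast
      then have "interior K = {}"
        using S assms(2) compact_homeomorphic_lowdim_interior by blast
      moreover have "K \<subseteq> M"
        using \<open>\<Union>\<K> = U\<close> \<open>K \<in> \<K>\<close> openin_imp_subset[OF U(1)] by blast
      ultimately show ?thesis
        by (simp add: \<K>0_def)
    qed
    moreover have "countable \<K>"
      by (simp add: \<K>_def)
    ultimately show ?thesis by blast
  qed
  define \<U> where "\<U> = {U. openin (top_of_set M) U \<and> top_of_set U homeomorphic_space Euclidean_space d}"
  obtain \<V> where \<V>: "\<V> \<subseteq> \<U>" "countable \<V>" "\<Union>\<V> = \<Union>\<U>"
    using Lindelof_openin[of \<U> M] unfolding \<U>_def by blast
  have "\<Union>\<U> = M"
    using assms(1) openin_imp_subset unfolding \<U>_def topological_submanifold_def by fast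
  obtain k where k: "\<And>U. U \<in> \<U> \<Longrightarrow> countable (k U) \<and> \<Union>(k U) = U \<and> k U \<subseteq> \<K>0"
    using chart unfolding \<U>_def by (metis mem_Collect_eq)
  show thesis
  proof (rule that[of "\<Union>(k ` \<V>)"])
    show "countable (\<Union>(k ` \<V>))"
      using k \<V> by blast
    have "\<Union>(\<Union>(k ` \<V>)) = (\<Union>U\<in>\<V>. \<Union>(k U))"
      by blast
    also have "\<dots> = \<Union>\<V>"
      using k \<V>(1) by (metis (no_types, lifting) SUP_cong image_ident subsetD)
    finally show "\<Union>(\<Union>(k ` \<V>)) = M"
      using \<V>(3) \<open>\<Union>\<U> = M\<close> by simp
    show "compact K \<and> interior K = {}" if "K \<in> \<Union>(k ` \<V>)" for K
      using that k \<V>(1) unfolding \<K>0_def by blast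
  qed
qed

lemma DIM_complex_vec: "DIM(complex ^ 'n) = 2 * CARD('n)"
  by simp

lemma lower_dim_manifolds_dense_Compl:
  fixes E :: "(complex ^ 'n) set"
  assumes "consists_of_lower_dim_manifolds E"
  shows "closure (- E) = UNIV"
proof -
  obtain \<M> where \<M>: "countable \<M>" "E = \<Union>\<M>"
    "\<And>M. M \<in> \<M> \<Longrightarrow> \<exists>d < 2 * CARD('n). topological_submanifold d M"
    using assms unfolding consists_of_lower_dim_manifolds_def by blast
  have "\<exists>\<K>. countable \<K> \<and> \<Union>\<K> = M \<and> (\<forall>K\<in>\<K>. compact K \<and> interior K = {})" if "M \<in> \<M>" for M
    using \<M>(3)[OF that] topological_submanifold_sigma_compact[of _ M] 
    by (metis DIM_complex_vec)
  then obtain k where k: "\<And>M. M \<in> \<M> \<Longrightarrow> countable (k M) \<and> \<Union>(k M) = M \<and>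
      (\<forall>K\<in>k M. compact K \<and> interior K = {})"
    by metis
  have "closure (- \<Union>(\<Union>(k ` \<M>))) = UNIV"
    using k \<M>(1) by (intro dense_Compl_countable_Union) (auto intro: compact_imp_closed)
  moreover have "\<Union>(\<Union>(k ` \<M>)) = E"
    using k \<M>(2) by fastforce
  ultimately show ?thesis by simp
qed

subsection \<open>Coefficients of bounded and of starlike functions on the disc\<close>

text \<open>The tail of the series divided by \<open>z ^ k\<close> is a power series converging on
  the same ball, so the quotient is holomorphic there, also at 0.\<close>

lemma power_series_gap_factor:
  fixes d :: "nat \<Rightarrow> complex"
  assumes "\<And>z. z \<in> ball 0 R \<Longrightarrow> (\<lambda>n. d n * z ^ n) sums f z"
    and "0 < k" and "\<And>n. 0 < n \<Longrightarrow> n < k \<Longrightarrow> d n = 0"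
  obtains h where "h holomorphic_on ball 0 R" "h 0 = d k"
    "\<And>z. z \<in> ball 0 R \<Longrightarrow> f z = d 0 + z ^ k * h z"
proof -
  \<comment> \<open>\<open>d k\<close> is the value that removes the singularity of the quotient at
    0.\<close>
  define h where "h = (\<lambda>z. if z = 0 then d k else (f z - d 0) / z ^ k)"
  have sums: "(\<lambda>n. d (n + k) * (z - 0) ^ n) sums h z" if z: "z \<in> ball 0 R" for z
  proof (cases "z = 0")
    case True
    then show ?thesis
      using powser_sums_zero[of "\<lambda>n. d (n + k)"] by (simp add: h_def)
  next
    case False
    have "(\<Sum>n<k. d n * z ^ n) = (\<Sum>n\<in>{0}. d n * z ^ n)"
      using assms(2,3) by (intro sum.mono_neutral_right) auto
    then have "(\<lambda>n. d (n + k) * z ^ (n + k)) sums (f z - d 0)"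
      using sums_split_initial_segment[OF assms(1)[OF z], of k] by simp
    then have "(\<lambda>n. d (n + k) * z ^ (n + k) / z ^ k) sums ((f z - d 0) / z ^ k)"
      by (rule sums_divide)
    then show ?thesis
      using False by (simp add: h_def power_add)
  qed
  show thesis
  proof (rule that)
    show "h holomorphic_on ball 0 R"
      using sums by (rule power_series_holomorphic)
    show "h 0 = d k"
      by (simp add: h_def)
    show "f z = d 0 + z ^ k * h z" if "z \<in> ball 0 R" for z
      using assms(1)[of 0] powser_sums_zero[of d] sums_unique2[of "\<lambda>n. d n * 0 ^ n"] that assms(2)
      by (auto simp: h_def)
  qed
qed

lemma holomorphic_gap_factor:
  assumes "f holomorphic_on ball 0 R" "0 < k"
    and "\<And>n. 0 < n \<Longrightarrow> n < k \<Longrightarrow> (deriv ^^ n) f 0 = 0"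
  obtains h where "h holomorphic_on ball 0 R"
    "\<And>z. z \<in> ball 0 R \<Longrightarrow> f z = f 0 + z ^ k * h z"
proof -
  have "(\<lambda>n. (deriv ^^ n) f 0 / fact n * z ^ n) sums f z" if "z \<in> ball 0 R" for z
    using holomorphic_power_series[OF assms(1) that] by simp
  from power_series_gap_factor[OF this assms(2)] assms(3) show thesis
    using that by (metis (no_types, lifting) div_by_1 div_0 fact_0 funpow_0)
qed

text \<open>Schwarz's lemma for a zero of order \<open>k\<close>: on the circle of radius r the
  hypothesis bounds \<open>h\<close> by r^(-k), the maximum modulus principle carries this inside,
  and r tends to 1.\<close>

lemma schwarz_order:
  fixes z :: complex
  assumes h: "h holomorphic_on ball 0 1" and bd: "\<And>z. z \<in> ball 0 1 \<Longrightarrow> norm (z ^ k * h z) \<le> 1"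
    and z: "z \<in> ball 0 1"
  shows "norm (h z) \<le> 1"
proof -
  have le: "norm (h z) \<le> inverse r ^ k" if r: "norm z < r" "r < 1" for r
  proof -
    have "0 < r"
      using r(1) norm_ge_zero[of z] by linarith
    show ?thesis
    proof (rule maximum_modulus_frontier[of h "ball 0 r"])
      show "h holomorphic_on interior (ball 0 r)"
        using h r by (auto intro: holomorphic_on_subset)
      show "continuous_on (closure (ball 0 r)) h"
        using r \<open>0 < r\<close> holomorphic_on_imp_continuous_on[OF h]
        by (auto intro: continuous_on_subset)
      fix w :: complex assume "w \<in> frontier (ball 0 r)"
      then have w: "norm w = r"
        using \<open>0 < r\<close> by (simp add: frontier_ball)
      then have "r ^ k * norm (h w) \<le> 1"
        using bd[of w] r by (simp add: norm_mult norm_power)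
      then show "norm (h w) \<le> inverse r ^ k"
        using \<open>0 < r\<close> by (simp add: field_simps)
    qed (use r in auto)
  qed
  have "((\<lambda>r. inverse r ^ k) \<longlongrightarrow> inverse 1 ^ k) (at_left (1::real))"
    by (intro tendsto_intros) auto
  moreover have "\<forall>\<^sub>F r in at_left 1. norm (h z) \<le> inverse r ^ k"
    using z le eventually_at_left_real[of "norm z" 1] by (auto elim: eventually_mono)
  ultimately show ?thesis
    using tendsto_lowerbound by fastforce
qed

text \<open>The squares of the two sides differ by the product of 1 - |c|^2 and 1 - |w|^2. This is
  the bound 1 for a disc automorphism with the quotient cleared.\<close>

lemma moebius_norm_le:
  fixes w c :: complex
  assumes "norm w \<le> 1" "norm c \<le> 1"
  shows "norm (w - c) \<le> norm (1 - cnj c * w)"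
proof -
  have "(norm (1 - cnj c * w))\<^sup>2 - (norm (w - c))\<^sup>2 = (1 - (norm c)\<^sup>2) * (1 - (norm w)\<^sup>2)"
    unfolding cmod_power2 by (simp add: power2_eq_square algebra_simps)
  moreover have "(1 - (norm c)\<^sup>2) * (1 - (norm w)\<^sup>2) \<ge> 0"
    using assms by (simp add: power_le_one)
  ultimately show ?thesis
    using norm_ge_zero by (smt (verit) power2_le_imp_le)
qed

text \<open>A geometric sum that vanishes unless its ratio is 1. Averaging a power series over these
  rotations thus keeps exactly the coefficients whose index is a multiple of
  \<open>k\<close>.\<close>

lemma root_of_unity_average:
  assumes "0 < k"
  shows "(\<Sum>j<k. (cis (2 * pi / k) ^ j) ^ n) / of_nat k = (if k dvd n then 1 else (0::complex))"
proof -
  define \<omega> where "\<omega> = cis (2 * pi / k) ^ n"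
  have "cis (2 * pi / k) ^ k = 1"
    using assms by (simp add: Complex.DeMoivre)
  then have "\<omega> ^ k = 1"
    unfolding \<omega>_def by (metis power_mult mult.commute power_one)
  have "\<omega> = 1 \<longleftrightarrow> k dvd n"
  proof -
    have "\<omega> = cis (2 * pi * n / k)"
      by (simp add: \<omega>_def Complex.DeMoivre mult_ac)
    then show ?thesis
      using assms complex_root_unity_eq_1[of k n]
      by (simp add: cis_conv_exp mult_ac)
  qed
  have "(\<Sum>j<k. (cis (2 * pi / k) ^ j) ^ n) = (\<Sum>j<k. \<omega> ^ j)"
    by (simp add: \<omega>_def mult.commute flip: power_mult)
  also have "\<dots> = (if k dvd n then of_nat k else 0)"
  proof (cases "k dvd n")
    case True
    then show ?thesis using \<open>\<omega> = 1 \<longleftrightarrow> k dvd n\<close> by simp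
  next
    case False
    then show ?thesis
      using \<open>\<omega> = 1 \<longleftrightarrow> k dvd n\<close> \<open>\<omega> ^ k = 1\<close> geometric_sum[of \<omega> k] by simp
  qed
  finally show ?thesis
    using assms by simp
qed

text \<open>Averaging \<phi> over the rotations by \<open>k\<close>-th roots of unity keeps the
  bound 1 and leaves only powers of z^k. A disc automorphism then moves the constant term to 0, and
  Schwarz's lemma for order \<open>k\<close> bounds the next coefficient.\<close>

lemma schwarz_pick_coefficient:
  assumes hol: "\<phi> holomorphic_on ball 0 1" and bd: "\<And>z. z \<in> ball 0 1 \<Longrightarrow> norm (\<phi> z) \<le> 1"
    and k: "0 < k"
  shows "norm ((deriv ^^ k) \<phi> 0 / fact k) \<le> 1 - (norm (\<phi> 0))\<^sup>2"
proof -
  define c where "c = (\<lambda>n. (deriv ^^ n) \<phi> 0 / fact n)"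
  define \<omega> where "\<omega> = (\<lambda>j::nat. cis (2 * pi / k) ^ j)"
  define \<alpha> where "\<alpha> = (\<lambda>z. (\<Sum>j<k. \<phi> (\<omega> j * z)) / of_nat k)"
  have norm_\<omega>: "norm (\<omega> j) = 1" for j
    by (simp add: \<omega>_def norm_power)
  have sums: "(\<lambda>n. (if k dvd n then c n else 0) * z ^ n) sums \<alpha> z" if z: "z \<in> ball 0 1" for z
  proof -
    have "(\<lambda>n. c n * (\<omega> j * z) ^ n) sums \<phi> (\<omega> j * z)" for j
      using holomorphic_power_series[OF hol, of "\<omega> j * z"] z norm_\<omega>
      by (simp add: c_def norm_mult)
    then have "(\<lambda>n. (\<Sum>j<k. c n * (\<omega> j * z) ^ n) / of_nat k) sums \<alpha> z"
      unfolding \<alpha>_def by (intro sums_divide sums_sum)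
    moreover have "(\<Sum>j<k. c n * (\<omega> j * z) ^ n) / of_nat k = (if k dvd n then c n else 0) * z ^ n"
      for n
    proof -
      have "(\<Sum>j<k. c n * (\<omega> j * z) ^ n) / of_nat k =
          c n * z ^ n * ((\<Sum>j<k. \<omega> j ^ n) / of_nat k)"
        by (simp add: sum_distrib_left power_mult_distrib mult_ac)
      then show ?thesis
        unfolding \<omega>_def root_of_unity_average[OF k] by simp
    qed
    ultimately show ?thesis by simp
  qed
  obtain h where h: "h holomorphic_on ball 0 1" "h 0 = c k"
    and \<alpha>: "\<And>z. z \<in> ball 0 1 \<Longrightarrow> \<alpha> z = c 0 + z ^ k * h z"
    using power_series_gap_factor[where d = "\<lambda>n. if k dvd n then c n else 0", OF sums k]
      nat_dvd_not_less by auto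
  have c0: "c 0 = \<phi> 0"
    by (simp add: c_def)
  have \<alpha>_bd: "norm (\<alpha> z) \<le> 1" if "z \<in> ball 0 1" for z
  proof -
    have "norm (\<Sum>j<k. \<phi> (\<omega> j * z)) \<le> of_nat (card {..<k}) * 1"
      using that by (intro sum_norm_bound bd) (simp add: norm_mult norm_\<omega>)
    then show ?thesis
      using k by (simp add: \<alpha>_def norm_divide)
  qed
  \<comment> \<open>The factor \<open>r\<close> keeps \<open>r * c 0\<close> strictly inside the
    disc even if \<open>c 0\<close> has norm 1, so the Moebius denominator has no zero;
    \<open>r\<close> tends to 1 at the end.\<close>
  have key: "r * norm (c k) \<le> 1 - r\<^sup>2 * (norm (c 0))\<^sup>2" if r: "0 < r" "r < 1" for r :: real
  proof -
    \<comment> \<open>\<open>z ^ k * g z\<close> is the disc automorphism sending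
      \<open>r * c 0\<close> to 0, applied to \<open>r * \<alpha> z\<close>.\<close>
    define g where "g = (\<lambda>z. r * h z / (1 - cnj (r * c 0) * (r * (c 0 + z ^ k * h z))))"
    have small: "norm (r * c 0) < 1"
      using mult_less_le_imp_less[of r 1 "norm (c 0)" 1] r bd[of 0] c0
      by (cases "c 0 = 0") (auto simp: norm_mult)
    have bd1: "norm (r * (c 0 + z ^ k * h z)) \<le> 1" if "z \<in> ball 0 1" for z
      using \<alpha>_bd[OF that] \<alpha>[OF that] r by (simp add: norm_mult mult_le_one)
    have ne: "1 - cnj (r * c 0) * (r * (c 0 + z ^ k * h z)) \<noteq> 0" if "z \<in> ball 0 1" for z
    proof
      assume *: "1 - cnj (r * c 0) * (r * (c 0 + z ^ k * h z)) = 0"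
      have "norm (cnj (r * c 0) * (r * (c 0 + z ^ k * h z))) = 
            norm (r * c 0) * norm (r * (c 0 + z ^ k * h z))"
        by (metis norm_mult complex_mod_cnj)
      also have "\<dots> \<le> norm (r * c 0) * 1"
        using bd1[OF that] by (intro mult_left_mono) auto
      also have "\<dots> < 1" using small by simp
      finally show False using * by (metis norm_one order_less_irrefl right_minus_eq)
    qed
    have "norm (g 0) \<le> 1"
    proof (rule schwarz_order[where k = k and h = g and z = 0])
      show "g holomorphic_on ball 0 1"
        unfolding g_def using ne by (intro holomorphic_intros h) auto
      fix z :: complex assume z: "z \<in> ball 0 1"
      have "norm (r * (c 0 + z ^ k * h z) - r * c 0)
          \<le> norm (1 - cnj (r * c 0) * (r * (c 0 + z ^ k * h z)))"
        using bd1[OF z] small by (intro moebius_norm_le) auto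
      then show "norm (z ^ k * g z) \<le> 1"
        using ne[OF z] unfolding g_def by (simp add: norm_divide divide_le_eq algebra_simps)
    qed auto
    moreover have "1 - cnj (r * c 0) * (r * c 0) = of_real (1 - r\<^sup>2 * (norm (c 0))\<^sup>2)"
      by (simp add: power2_eq_square mult_ac flip: complex_norm_square)
    moreover have "r\<^sup>2 * (norm (c 0))\<^sup>2 < 1"
      using small r power_less_one_iff[of "r * norm (c 0)" 2]
      by (simp add: norm_mult flip: power_mult_distrib)
    moreover from calculation(2) have "g 0 = r * c k / of_real (1 - r\<^sup>2 * (norm (c 0))\<^sup>2)"
      using k by (simp add: g_def h(2) power_0_left)
    ultimately show ?thesis
      using r by (simp add: norm_divide norm_mult divide_le_eq del: of_real_diff)
  qed
  have "((\<lambda>r. r * norm (c k)) \<longlongrightarrow> 1 * norm (c k)) (at_left (1::real))"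
    by (intro tendsto_intros)
  moreover have "((\<lambda>r. 1 - r\<^sup>2 * (norm (c 0))\<^sup>2) \<longlongrightarrow> 1 - 1\<^sup>2 * (norm (c 0))\<^sup>2) (at_left (1::real))"
    by (intro tendsto_intros)
  moreover have "\<forall>\<^sub>F r in at_left 1. r * norm (c k) \<le> 1 - r\<^sup>2 * (norm (c 0))\<^sup>2"
    using key eventually_at_left_real[of 0 1] by (auto elim: eventually_mono)
  ultimately have "norm (c k) \<le> 1 - (norm (c 0))\<^sup>2"
    using tendsto_le[of "at_left (1::real)"] by fastforce
  then show ?thesis
    by (simp add: c_def)
qed

text \<open>The quantity is the determinant of the symmetric 3 by 3 Toeplitz matrix with first row
  1, b, a. In the form 1 - 2 b^2 - a (a - 2 b^2) it can be estimated term by term, because a - 2 b^2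
  looks like a with k + 2 replaced by k - 6.\<close>

lemma toeplitz_det_bound:
  fixes \<tau> y a b :: complex and k :: nat
  assumes k: "1 \<le> k" and y: "norm y \<le> 1 - (norm \<tau>)\<^sup>2"
    and b: "b = 2 * \<tau> / of_nat k" and a: "a = y / of_nat k + (of_nat k + 2) * \<tau>\<^sup>2 / (of_nat k)\<^sup>2"
  shows "k \<le> 3 \<Longrightarrow> norm (1 - a\<^sup>2 - 2 * b\<^sup>2 + 2 * b\<^sup>2 * a)
            \<le> 1 + 8 / real k ^ 2 + (real k + 2) * (6 - real k) / real k ^ 4"
    and "k \<ge> 3 \<Longrightarrow> norm (1 - a\<^sup>2 - 2 * b\<^sup>2 + 2 * b\<^sup>2 * a)
            \<le> 1 + 8 / real k ^ 2 + (2 + real k) / real k ^ 3"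
proof -
  define s where "s = (norm \<tau>)\<^sup>2"
  have s: "0 \<le> s" "s \<le> 1" and ys: "norm y \<le> 1 - s"
    using y order_trans[OF norm_ge_zero y] unfolding s_def by auto
  have k0: "real k \<ge> 1" using k by simp
  \<comment> \<open>Over the common denominator k^2 the numerator is at most k (1 - s) + |u| s, a
    convex combination of k and |u|, hence at most v.\<close>
  have coeff: "norm (y / of_nat k + of_real u * \<tau>\<^sup>2 / (of_nat k)\<^sup>2) \<le> v / (real k)\<^sup>2"
    if "\<bar>u\<bar> \<le> v" "real k \<le> v" for u v :: real
  proof -
    have "norm (y / of_nat k + of_real u * \<tau>\<^sup>2 / (of_nat k)\<^sup>2)
        \<le> norm y / real k + \<bar>u\<bar> * s / (real k)\<^sup>2"
      by (rule norm_triangle_le) (simp add: norm_divide norm_mult norm_power s_def)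
    also have "\<dots> = (norm y * real k + \<bar>u\<bar> * s) / (real k)\<^sup>2"
      using k0 by (simp add: field_simps power2_eq_square)
    also have "norm y * real k + \<bar>u\<bar> * s \<le> (1 - s) * v + v * s"
      using s ys that k0 by (intro add_mono mult_mono) auto
    finally show ?thesis
      by (simp add: divide_right_mono algebra_simps)
  qed
  have na: "norm a \<le> (real k + 2) / (real k)\<^sup>2"
    using coeff[of "real k + 2" "real k + 2"] k0 by (simp add: a)
  have nb: "norm (2 * b\<^sup>2) \<le> 8 / (real k)\<^sup>2"
    using s k0 by (simp add: b norm_mult norm_power norm_divide power_divide power_mult_distrib
        divide_right_mono flip: s_def)
  have eq: "a - 2 * b\<^sup>2 = y / of_nat k + of_real (real k - 6) * \<tau>\<^sup>2 / (of_nat k)\<^sup>2"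
    using k by (simp add: a b power_divide power_mult_distrib diff_divide_distrib algebra_simps add_divide_distrib)
  have bound: "norm (1 - a\<^sup>2 - 2 * b\<^sup>2 + 2 * b\<^sup>2 * a)
      \<le> 1 + 8 / (real k)\<^sup>2 + (real k + 2) / (real k)\<^sup>2 * B" if "norm (a - 2 * b\<^sup>2) \<le> B" for B
  proof -
    have "1 - a\<^sup>2 - 2 * b\<^sup>2 + 2 * b\<^sup>2 * a = 1 - 2 * b\<^sup>2 - a * (a - 2 * b\<^sup>2)"
      by (simp add: power2_eq_square algebra_simps)
    also have "norm \<dots> \<le> norm (1::complex) + norm (2 * b\<^sup>2) + norm (a * (a - 2 * b\<^sup>2))"
      by (meson norm_triangle_ineq4 add_right_mono order_trans)
    also have "norm (a * (a - 2 * b\<^sup>2)) \<le> (real k + 2) / (real k)\<^sup>2 * B"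
      unfolding norm_mult using na that by (intro mult_mono) auto
    finally show ?thesis
      using nb by simp
  qed
  show "norm (1 - a\<^sup>2 - 2 * b\<^sup>2 + 2 * b\<^sup>2 * a)
      \<le> 1 + 8 / real k ^ 2 + (real k + 2) * (6 - real k) / real k ^ 4" if "k \<le> 3"
  proof -
    \<comment> \<open>The larger of k and |k - 6| is 6 - k up to k = 3 and k from there on; this is
      where the two cases of the bound come from.\<close>
    have "norm (a - 2 * b\<^sup>2) \<le> (6 - real k) / (real k)\<^sup>2"
      unfolding eq using that by (intro coeff) auto
    from bound[OF this] show ?thesis
      by (simp add: power2_eq_square power4_eq_xxxx)
  qed
  show "norm (1 - a\<^sup>2 - 2 * b\<^sup>2 + 2 * b\<^sup>2 * a) \<le> 1 + 8 / real k ^ 2 + (2 + real k) / real k ^ 3"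
    if "k \<ge> 3"
  proof -
    have "norm (a - 2 * b\<^sup>2) \<le> real k / (real k)\<^sup>2"
      unfolding eq using that by (intro coeff) auto
    from bound[OF this] show ?thesis
      using k by (simp add: power2_eq_square power3_eq_cube add_ac)
  qed
qed

text \<open>|1 + q|^2 - |1 - q|^2 = 4 Re q; this Cayley transform takes the right half plane to the
  disc.\<close>

lemma one_minus_over_one_plus_norm_le:
  fixes q :: complex
  assumes "Re q \<ge> 0"
  shows "norm ((1 - q) / (1 + q)) \<le> 1"
proof -
  have "(norm (1 - q))\<^sup>2 \<le> (norm (1 + q))\<^sup>2"
    using assms unfolding cmod_power2 by (simp add: power2_eq_square algebra_simps)
  then have "norm (1 - q) \<le> norm (1 + q)"
    by simp
  then show ?thesis
    by (simp add: norm_divide divide_le_eq_1)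
qed

text \<open>With q = G / (G + z G'), the Cayley transform (1 - q) / (1 + q) equals z G' / (2 G + z
  G'), is bounded by 1 and contains the factor z^k. Its quotient \<phi> by z^k is still bounded by
  1, so its coefficients obey the Schwarz-Pick bound, and \<open>a\<close> and \<open>b\<close> are
  recovered from them.\<close>

lemma starlike_slice_bound:
  fixes A :: "complex \<Rightarrow> complex" and k :: nat
  defines "G \<equiv> \<lambda>z. 1 + z ^ k * A z"
  assumes k: "1 \<le> k" and A: "A holomorphic_on ball 0 1"
    and ne: "\<And>z. z \<in> ball 0 1 \<Longrightarrow> G z + z * deriv G z \<noteq> 0"
    and pos: "\<And>z. z \<in> ball 0 1 \<Longrightarrow> Re (G z / (G z + z * deriv G z)) \<ge> 0"
    and b: "b = A 0" and a: "a = (deriv ^^ k) A 0 / fact k"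
  shows "k \<le> 3 \<Longrightarrow> norm (1 - a\<^sup>2 - 2 * b\<^sup>2 + 2 * b\<^sup>2 * a)
            \<le> 1 + 8 / real k ^ 2 + (real k + 2) * (6 - real k) / real k ^ 4"
    and "k \<ge> 3 \<Longrightarrow> norm (1 - a\<^sup>2 - 2 * b\<^sup>2 + 2 * b\<^sup>2 * a)
            \<le> 1 + 8 / real k ^ 2 + (2 + real k) / real k ^ 3"
proof -
  \<comment> \<open>\<open>N\<close> is z G' divided by z^k, continued holomorphically to 0.\<close>
  define N where "N = (\<lambda>z. of_nat k * A z + z * deriv A z)"
  define \<phi> where "\<phi> = (\<lambda>z. N z / (2 * G z + z ^ k * N z))"
  have dG: "z * deriv G z = z ^ k * N z" if "z \<in> ball 0 1" for z
  proof -
    have "(A has_field_derivative deriv A z) (at z)"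
      using A that holomorphic_derivI by blast
    then have "(G has_field_derivative (of_nat k * z ^ (k - 1) * A z + z ^ k * deriv A z)) (at z)"
      unfolding G_def by (auto intro!: derivative_eq_intros)
    then have "deriv G z = of_nat k * z ^ (k - 1) * A z + z ^ k * deriv A z"
      by (rule DERIV_imp_deriv)
    moreover have "z ^ k = z * z ^ (k - 1)"
      using k by (simp flip: power_Suc)
    ultimately show ?thesis
      by (simp add: N_def algebra_simps)
  qed
  have dne: "2 * G z + z ^ k * N z \<noteq> 0" 
    and W: "norm (z ^ k * \<phi> z) \<le> 1" if z: "z \<in> ball 0 1" for z
  proof -
    define q where "q = G z / (G z + z * deriv G z)"
    have "Re q \<ge> 0" using pos[OF z] by (simp add: q_def)
    then have "1 + q \<noteq> 0"
      by (auto simp: complex_eq_iff)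
    moreover have e: "2 * G z + z ^ k * N z = (G z + z * deriv G z) * (1 + q)"
      using ne[OF z] dG[OF z] by (simp add: q_def field_simps)
    ultimately show "2 * G z + z ^ k * N z \<noteq> 0"
      using ne[OF z] by simp
    have e2: "z ^ k * N z = (G z + z * deriv G z) * (1 - q)"
      using ne[OF z] dG[OF z] by (simp add: q_def field_simps)
    have "z ^ k * \<phi> z = (1 - q) / (1 + q)"
      using ne[OF z] unfolding \<phi>_def times_divide_eq_right e unfolding e2 by simp
    then show "norm (z ^ k * \<phi> z) \<le> 1"
      using one_minus_over_one_plus_norm_le[OF \<open>Re q \<ge> 0\<close>] by simp
  qed
  have A': "deriv A holomorphic_on ball 0 1"
    using A by (intro holomorphic_deriv) auto
  have \<phi>: "\<phi> holomorphic_on ball 0 1"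
    using dne unfolding \<phi>_def N_def G_def by (intro holomorphic_intros A A') auto
  have \<phi>_bd: "norm (\<phi> z) \<le> 1" if "z \<in> ball 0 1" for z
    using schwarz_order[OF \<phi> W that] .
  define FA where "FA = fps_expansion A 0"
  define F\<phi> where "F\<phi> = fps_expansion \<phi> 0"
  have FA: "A has_fps_expansion FA" and F\<phi>: "\<phi> has_fps_expansion F\<phi>"
    unfolding FA_def F\<phi>_def using A \<phi>
    by (auto intro!: has_fps_expansion_fps_expansion[of "ball 0 1"])
  \<comment> \<open>The relation \<phi> (2 G + z^k N) = N is turned into an identity of formal power
    series, so that coefficients can be compared.\<close>
  have lhs: "(\<lambda>z. \<phi> z * (2 * (1 + z ^ k * A z) + z ^ k * (of_nat k * A z + z * deriv A z)))
      has_fps_expansion F\<phi> * (fps_const 2 * (1 + fps_X ^ k * FA) + 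
           fps_X ^ k * (fps_const (of_nat k) * FA + fps_X * fps_deriv FA))"
    by (intro fps_expansion_intros FA F\<phi>)
  have rhs: "(\<lambda>z. of_nat k * A z + z * deriv A z) has_fps_expansion 
      fps_const (of_nat k) * FA + fps_X * fps_deriv FA"
    by (intro fps_expansion_intros FA)
  have eq: "\<forall>\<^sub>F z in nhds 0. \<phi> z * (2 * (1 + z ^ k * A z) + z ^ k * (of_nat k * A z + z * deriv A z)) =
      of_nat k * A z + z * deriv A z"
  proof -
    have "\<forall>\<^sub>F z in nhds 0. z \<in> ball (0::complex) 1"
      by (intro eventually_nhds_in_open) auto
    then show ?thesis
      by eventually_elim (use dne in \<open>auto simp: \<phi>_def N_def G_def\<close>)
  qed
  have fps: "F\<phi> * (fps_const 2 * (1 + fps_X ^ k * FA) + 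
           fps_X ^ k * (fps_const (of_nat k) * FA + fps_X * fps_deriv FA)) = fps_const (of_nat k) * FA + fps_X * fps_deriv FA"
    using lhs has_fps_expansion_cong[OF eq refl] rhs fps_expansion_unique_complex by blast
  have "fps_const 2 * F\<phi> + fps_X ^ k * (F\<phi> * (fps_const 2 * FA + fps_const (of_nat k) * FA + fps_X * fps_deriv FA))
     = fps_const (of_nat k) * FA + fps_X * fps_deriv FA"
    using fps by (simp add: algebra_simps)
  then have "fps_nth (fps_const 2 * F\<phi> + fps_X ^ k * (F\<phi> * (fps_const 2 * FA + fps_const (of_nat k) * FA + fps_X * fps_deriv FA))) k
     = fps_nth (fps_const (of_nat k) * FA + fps_X * fps_deriv FA) k"
    by simp
  \<comment> \<open>The second of the two equal terms on the right comes from z A'.\<close>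
  then have eqk: "2 * fps_nth F\<phi> k + fps_nth F\<phi> 0 * (2 * fps_nth FA 0 + of_nat k * fps_nth FA 0)
      = of_nat k * fps_nth FA k + of_nat k * fps_nth FA k"
    using k by (simp add: fps_X_power_mult_nth fps_mult_left_const_nth)
  define y where "y = (deriv ^^ k) \<phi> 0 / fact k"
  have y: "fps_nth F\<phi> k = y" "fps_nth F\<phi> 0 = \<phi> 0" "fps_nth FA 0 = b" "fps_nth FA k = a"
    by (simp_all add: F\<phi>_def FA_def fps_expansion_def y_def a b)
  have \<phi>0: "\<phi> 0 = of_nat k * b / 2"
    using k by (simp add: \<phi>_def N_def G_def b power_0_left)
  have yb: "norm y \<le> 1 - (norm (\<phi> 0))\<^sup>2"
    unfolding y_def using k by (intro schwarz_pick_coefficient \<phi> \<phi>_bd) auto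
  have k0: "(of_nat k :: complex) \<noteq> 0" using k by simp
  have "b = 2 * \<phi> 0 / of_nat k"
    using k0 by (simp add: \<phi>0)
  moreover have "a = y / of_nat k + (of_nat k + 2) * (\<phi> 0)\<^sup>2 / (of_nat k)\<^sup>2"
  proof -
    have "2 * y + \<phi> 0 * (2 * b + of_nat k * b) = 2 * of_nat k * a"
      using eqk by (simp add: y)
    then have "a = (2 * y + \<phi> 0 * (2 * b + of_nat k * b)) / (2 * of_nat k)"
      using k0 by simp
    also have "\<dots> = y / of_nat k + (of_nat k + 2) * (\<phi> 0)\<^sup>2 / (of_nat k)\<^sup>2"
      using k0 by (simp add: \<phi>0 field_simps power2_eq_square)
    finally show ?thesis .
  qed
  ultimately show "k \<le> 3 \<Longrightarrow> norm (1 - a\<^sup>2 - 2 * b\<^sup>2 + 2 * b\<^sup>2 * a)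
            \<le> 1 + 8 / real k ^ 2 + (real k + 2) * (6 - real k) / real k ^ 4"
    and "k \<ge> 3 \<Longrightarrow> norm (1 - a\<^sup>2 - 2 * b\<^sup>2 + 2 * b\<^sup>2 * a)
            \<le> 1 + 8 / real k ^ 2 + (2 + real k) / real k ^ 3"
    using toeplitz_det_bound[OF k yb] by auto
qed

subsection \<open>Holomorphic functions of several variables\<close>

lemma norm_vector_scalar_mult: "norm (c *s v) = norm c * norm (v :: complex ^ 'n)"
  by (simp add: norm_vec_def norm_mult L2_set_right_distrib)

text \<open>Yields the product and continuity rules for scaling by complex numbers;
  \<open>scaleR\<close> covers real ones only.\<close>

lemma bounded_bilinear_vector_scalar_mult:
  "bounded_bilinear ((*s) :: complex \<Rightarrow> complex ^ 'n \<Rightarrow> complex ^ 'n)"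
  by (rule bounded_bilinear.intro)
    (auto simp: vec_eq_iff algebra_simps norm_vector_scalar_mult intro!: exI[of _ 1])

lemmas has_derivative_vector_scalar_mult [derivative_intros] =
  bounded_bilinear.FDERIV[OF bounded_bilinear_vector_scalar_mult]
lemmas continuous_on_vector_scalar_mult [continuous_intros] =
  bounded_bilinear.continuous_on[OF bounded_bilinear_vector_scalar_mult]

lemma scaleR_eq_vector_scalar_mult: "r *\<^sub>R v = complex_of_real r *s (v :: complex ^ 'n)"
  by (simp add: vec_eq_iff) (simp add: scaleR_conv_of_real)

lemma clinear_funI:
  fixes A :: "complex ^ 'n \<Rightarrow> complex"
  assumes "\<And>u v. A (u + v) = A u + A v" and "\<And>c v. A (c *s v) = c * A v"
  shows "Vector_Spaces.linear (*s) (*) A"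
  using assms by unfold_locales (auto simp: algebra_simps)

lemma clinear_mapI:
  fixes A :: "complex ^ 'n \<Rightarrow> complex ^ 'n"
  assumes "\<And>u v. A (u + v) = A u + A v" and "\<And>c v. A (c *s v) = c *s A v"
  shows "Vector_Spaces.linear (*s) (*s) A"
  using assms by unfold_locales auto

context
  fixes f :: "complex ^ 'n \<Rightarrow> complex" and S :: "(complex ^ 'n) set"
  assumes hol: "holomorphic_fun_on f S"
begin

lemma holomorphic_fun_on_has_derivative:
  assumes "z \<in> S"
  shows "(f has_derivative frechet_derivative f (at z)) (at z)"
  using hol assms unfolding holomorphic_fun_on_def
  by (metis differentiable_def frechet_derivative_works)

lemma holomorphic_fun_on_frechet_derivative_mult:
  assumes "z \<in> S"
  shows "frechet_derivative f (at z) (c *s v) = c * frechet_derivative f (at z) v"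
proof -
  obtain A where A: "(f has_derivative A) (at z)" "Vector_Spaces.linear (*s) (*) A"
    using hol assms unfolding holomorphic_fun_on_def by blast
  then have "frechet_derivative f (at z) = A"
    using frechet_derivative_at by metis
  then show ?thesis
    using A(2) by (simp add: module_hom.scale Vector_Spaces.linear_iff_module_hom)
qed

lemma holomorphic_fun_on_continuous_on: "continuous_on S f"
  using holomorphic_fun_on_has_derivative has_derivative_continuous
  by (blast intro: continuous_at_imp_continuous_on)

text \<open>Complex linearity turns the real derivative supplied by the chain rule into
  multiplication by a complex number, so one-variable theory applies on each complex line.\<close>

lemma holomorphic_fun_on_slice:
  assumes "w + t *s v \<in> S"
  shows "((\<lambda>t. f (w + t *s v)) has_field_derivative frechet_derivative f (at (w + t *s v)) v) (at t)"
proof -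
  have "((\<lambda>t. w + t *s v) has_derivative (\<lambda>h. h *s v)) (at t)"
    by (auto intro!: derivative_eq_intros)
  from has_derivative_compose[OF this holomorphic_fun_on_has_derivative[OF assms]]
  show ?thesis
    unfolding has_field_derivative_def holomorphic_fun_on_frechet_derivative_mult[OF assms]
    by (simp add: mult_commute_abs)
qed

text \<open>Cauchy's formula for the first derivative of the slice, with the circle parametrised
  over the unit interval; du cancels one of the two factors u in the denominator. In this form the
  derivative can be differentiated again under the integral sign.\<close>

lemma holomorphic_fun_on_cauchy:
  assumes r: "0 < r" and S: "\<And>t. norm t \<le> r \<Longrightarrow> w + t *s v \<in> S"
  shows "frechet_derivative f (at w) v = integral (cbox 0 1)
    (\<lambda>s. f (w + (r * exp (2 * of_real pi * \<i> * of_real s)) *s v)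
      / (r * exp (2 * of_real pi * \<i> * of_real s)))"
proof -
  define g where "g = (\<lambda>t. f (w + t *s v))"
  have der: "(g has_field_derivative frechet_derivative f (at (w + t *s v)) v) (at t)"
    if "norm t \<le> r" for t
    unfolding g_def by (rule holomorphic_fun_on_slice) (use S that in auto)
  have "g holomorphic_on cball 0 r"
    unfolding holomorphic_on_def field_differentiable_def
    using der has_field_derivative_at_within by fastforce
  then have "(g has_field_derivative (1 / (2 * of_real pi * \<i>) *
      contour_integral (circlepath 0 r) (\<lambda>u. g u / (u - 0)\<^sup>2))) (at 0)"
    using r by (intro Cauchy_derivative_integral_circlepath(2))
      (auto intro: holomorphic_on_imp_continuous_on holomorphic_on_subset)
  moreover have "(g has_field_derivative frechet_derivative f (at w) v) (at 0)"
    using der[of 0] r by simp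
  ultimately have "frechet_derivative f (at w) v = 1 / (2 * of_real pi * \<i>) *
      contour_integral (circlepath 0 r) (\<lambda>u. g u / (u - 0)\<^sup>2)"
    using DERIV_unique by blast
  also have "\<dots> = 1 / (2 * of_real pi * \<i>) * integral {0..1} (\<lambda>s. g (circlepath 0 r s) / (circlepath 0 r s)\<^sup>2
       * (2 * pi * \<i> * r * exp (2 * of_real pi * \<i> * of_real s)))"
    by (simp add: contour_integral_integral vector_derivative_circlepath)
  also have "\<dots> = integral {0..1} (\<lambda>s. 1 / (2 * of_real pi * \<i>) * (g (circlepath 0 r s) / (circlepath 0 r s)\<^sup>2
       * (2 * pi * \<i> * r * exp (2 * of_real pi * \<i> * of_real s))))"
    by (rule integral_mult_right[symmetric])
  also have "\<dots> = integral {0..1} (\<lambda>s. f (w + (r * exp (2 * of_real pi * \<i> * of_real s)) *s v)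
      / (r * exp (2 * of_real pi * \<i> * of_real s)))"
    using r by (intro integral_cong) (simp add: g_def circlepath power2_eq_square field_simps)
  finally show ?thesis by simp
qed

end

text \<open>Continuity of the derivative is not part of the definition of holomorphy, so it is
  gained first, from the Cauchy representation; then Leibniz's rule differentiates that
  representation.\<close>

lemma holomorphic_fun_on_frechet_derivative:
  fixes f :: "complex ^ 'n \<Rightarrow> complex"
  assumes hol: "holomorphic_fun_on f S" and "open S"
  shows "holomorphic_fun_on (\<lambda>w. frechet_derivative f (at w) v) S"
proof -
  define e where "e = (\<lambda>r s. complex_of_real r * exp (2 * of_real pi * \<i> * of_real s))"
  have norm_e: "norm (e r s) = \<bar>r\<bar>" for r s
    by (simp add: e_def norm_mult)
  have e0: "e r s \<noteq> 0" if "r > 0" for r s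
    using that by (simp add: e_def)
  have cont_e: "continuous_on A (e r)" for r A
    unfolding e_def by (intro continuous_intros)
  have rep: "\<exists>r>0. \<exists>U. open U \<and> convex U \<and> w0 \<in> U \<and> U \<subseteq> S \<and>
      (\<forall>w\<in>U. \<forall>s. w + e r s *s v \<in> S) \<and>
      (\<forall>w\<in>U. frechet_derivative f (at w) v = integral (cbox 0 1) (\<lambda>s. f (w + e r s *s v) / e r s))"
    if w0: "w0 \<in> S" for w0 v
  proof -
    obtain d where d: "0 < d" "ball w0 d \<subseteq> S"
      using \<open>open S\<close> w0 openE by blast
    \<comment> \<open>This radius gives r |v| < d / 2, so the circles around all points of
      \<open>ball w0 (d / 2)\<close> stay inside \<open>S\<close>; the summand 1 covers v =
      0.\<close>
    define r where "r = d / 2 / (norm v + 1)"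
    have r: "0 < r"
      using d unfolding r_def by (intro divide_pos_pos) (auto simp: add_nonneg_pos)
    have "norm v + 1 \<noteq> 0"
      using norm_ge_zero[of v] by linarith
    then have "r * (norm v + 1) = d / 2"
      using nonzero_eq_divide_eq r_def by blast
    then have rv: "r * norm v < d / 2"
      using r by (simp add: algebra_simps)
    have inS: "w + t *s v \<in> S" if "w \<in> ball w0 (d / 2)" "norm t \<le> r" for w t
    proof -
      have "norm (t *s v) \<le> r * norm v"
        using that by (simp add: norm_vector_scalar_mult mult_right_mono)
      then have "dist w (w + t *s v) < d / 2"
        using rv by (simp add: dist_norm)
      then have "dist w0 (w + t *s v) < d"
        using that(1) dist_triangle[of w0 "w + t *s v" w] by simp
      then show ?thesis
        using d by auto
    qed
    have "frechet_derivative f (at w) v = integral (cbox 0 1) (\<lambda>s. f (w + e r s *s v) / e r s)"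
      if "w \<in> ball w0 (d / 2)" for w
      unfolding e_def using inS that r by (intro holomorphic_fun_on_cauchy[OF hol]) auto
    moreover have "ball w0 (d / 2) \<subseteq> S"
      using d subset_ball[of "d / 2" d w0] by auto
    ultimately show ?thesis
      using d r inS norm_e by (intro exI[of _ r] conjI exI[of _ "ball w0 (d / 2)"]) auto
  qed
  have cont: "continuous_on S (\<lambda>w. frechet_derivative f (at w) v)" for v
  proof (rule continuous_at_imp_continuous_on, rule ballI)
    fix w0 assume "w0 \<in> S"
    then obtain r U where r: "r > 0" and U: "open U" "w0 \<in> U"
      "\<And>w s. w \<in> U \<Longrightarrow> w + e r s *s v \<in> S"
      and eq: "\<And>w. w \<in> U \<Longrightarrow> frechet_derivative f (at w) v
        = integral (cbox 0 1) (\<lambda>s. f (w + e r s *s v) / e r s)"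
      using rep[of w0 v] by blast
    have "continuous_on U (\<lambda>w. integral (cbox 0 1) (\<lambda>s. f (w + e r s *s v) / e r s))"
      using U(3) e0[OF r]
      by (intro integral_continuous_on_param)
        (auto simp: case_prod_beta intro!: continuous_intros continuous_on_compose2[OF cont_e]
          continuous_on_compose2[OF holomorphic_fun_on_continuous_on[OF hol]])
    then have "continuous_on U (\<lambda>w. frechet_derivative f (at w) v)"
      using eq by (simp cong: continuous_on_cong)
    then show "isCont (\<lambda>w. frechet_derivative f (at w) v) w0"
      using U continuous_on_eq_continuous_at by blast
  qed
  \<comment> \<open>\<open>leibniz_rule\<close> takes the derivative of the integrand as a
    continuous family of bounded linear maps, hence this operator-valued form.\<close>
  define D where "D = (\<lambda>w. Blinfun (frechet_derivative f (at w)))"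
  have D: "blinfun_apply (D w) = frechet_derivative f (at w)" if "w \<in> S" for w
    unfolding D_def using holomorphic_fun_on_has_derivative[OF hol that]
    by (intro bounded_linear_Blinfun_apply has_derivative_bounded_linear)
  have cont_D: "continuous_on S D"
    using cont D by (intro continuous_on_blinfun_componentwise) (simp cong: continuous_on_cong)
  show ?thesis
    unfolding holomorphic_fun_on_def
  proof
    fix w0 assume "w0 \<in> S"
    then obtain r U where r: "r > 0" and U: "open U" "convex U" "w0 \<in> U"
      "\<And>w s. w \<in> U \<Longrightarrow> w + e r s *s v \<in> S"
      and eq: "\<And>w. w \<in> U \<Longrightarrow> frechet_derivative f (at w) v
        = integral (cbox 0 1) (\<lambda>s. f (w + e r s *s v) / e r s)"
      using rep[of w0 v] by blast
    define fx where "fx = (\<lambda>w s. blinfun_mult_right (inverse (e r s)) o\<^sub>L D (w + e r s *s v))"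
    have fx: "blinfun_apply (fx w s) u = frechet_derivative f (at (w + e r s *s v)) u / e r s"
      if "w \<in> U" for w s u
      using U(4)[OF that] by (simp add: fx_def D field_simps)
    have cont_fx: "continuous_on (U \<times> cbox 0 1) (\<lambda>(w, s). fx w s)"
      unfolding fx_def case_prod_beta using U(4) e0[OF r]
      by (intro continuous_intros bounded_linear.continuous_on[OF bounded_linear_blinfun_mult_right]
          continuous_on_compose2[OF cont_e] continuous_on_compose2[OF cont_D]) auto
    have "((\<lambda>w. integral (cbox 0 1) (\<lambda>s. f (w + e r s *s v) / e r s)) has_derivative
        integral (cbox 0 1) (fx w0)) (at w0 within U)"
    proof (rule leibniz_rule[OF _ _ cont_fx U(3,2)])
      fix w and s :: real assume w: "w \<in> U"
      have "((\<lambda>w. w + e r s *s v) has_derivative (\<lambda>h. h)) (at w)"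
        by (auto intro!: derivative_eq_intros)
      from has_derivative_compose[OF this holomorphic_fun_on_has_derivative[OF hol U(4)[OF w]]]
      have "((\<lambda>w. f (w + e r s *s v) / e r s) has_derivative blinfun_apply (fx w s)) (at w)"
        unfolding fx[OF w, abs_def] by (rule bounded_linear.has_derivative[OF bounded_linear_divide])
      then show "((\<lambda>w. f (w + e r s *s v) / e r s) has_derivative blinfun_apply (fx w s)) (at w within U)"
        by (rule has_derivative_at_withinI)
    next
      fix w assume "w \<in> U"
      then show "(\<lambda>s. f (w + e r s *s v) / e r s) integrable_on cbox 0 1"
        using U(4) e0[OF r] by (intro integrable_continuous continuous_intros cont_e
          continuous_on_compose2[OF holomorphic_fun_on_continuous_on[OF hol]]) auto
    qed
    then have "((\<lambda>w. integral (cbox 0 1) (\<lambda>s. f (w + e r s *s v) / e r s)) has_derivative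
        integral (cbox 0 1) (fx w0)) (at w0)"
      unfolding at_within_open[OF U(3,1)] .
    then have "((\<lambda>w. frechet_derivative f (at w) v) has_derivative integral (cbox 0 1) (fx w0)) (at w0)"
      by (rule has_derivative_transform_within_open) (use U eq in auto)
    \<comment> \<open>Complex linearity of the derivative of \<open>f\<close> passes through the
      integral.\<close>
    moreover have "Vector_Spaces.linear (*s) (*) (blinfun_apply (integral (cbox 0 1) (fx w0)))"
    proof (rule clinear_funI)
      fix c u
      have "fx w0 integrable_on cbox 0 1"
      proof (rule integrable_continuous)
        have "continuous_on (cbox 0 1) (\<lambda>s. (w0, s))"
          by (intro continuous_intros)
        then show "continuous_on (cbox 0 1) (fx w0)"
          using continuous_on_compose2[OF cont_fx, of "cbox 0 1" "\<lambda>s. (w0, s)"] U(3)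
          by (fastforce simp: image_subset_iff)
      qed
      then have I: "blinfun_apply (integral (cbox 0 1) (fx w0)) u = integral (cbox 0 1) (\<lambda>s. fx w0 s u)" for u
        by (rule blinfun_apply_integral)
      have "fx w0 s (c *s u) = c * fx w0 s u" for s
        using fx[OF U(3)] holomorphic_fun_on_frechet_derivative_mult[OF hol U(4)[OF U(3)]] by simp
      then show "blinfun_apply (integral (cbox 0 1) (fx w0)) (c *s u)
          = c * blinfun_apply (integral (cbox 0 1) (fx w0)) u"
        unfolding I by simp
    qed (simp add: blinfun.add_right)
    ultimately show "\<exists>A. ((\<lambda>w. frechet_derivative f (at w) v) has_derivative A) (at w0) \<and>
        Vector_Spaces.linear (*s) (*) A"
      by blast
  qed
qed

section \<open>Iterated derivatives along complex lines and of radial maps\<close>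

lemma holomorphic_fun_on_diff_const:
  fixes f :: "complex ^ 'n \<Rightarrow> complex"
  assumes "holomorphic_fun_on f S"
  shows "holomorphic_fun_on (\<lambda>z. f z - c) S"
  unfolding holomorphic_fun_on_def
proof
  fix z assume "z \<in> S"
  then obtain A where A: "(f has_derivative A) (at z)" "Vector_Spaces.linear (*s) (*) A"
    using assms unfolding holomorphic_fun_on_def by blast
  have "((\<lambda>z. f z - c) has_derivative A) (at z)"
    by (auto intro!: derivative_eq_intros A)
  then show "\<exists>A. ((\<lambda>z. f z - c) has_derivative A) (at z) \<and> Vector_Spaces.linear (*s) (*) A"
    using A(2) by blast
qed

lemma higher_frechet_cong_open:
  assumes "open S" "w \<in> S" "\<And>w. w \<in> S \<Longrightarrow> f w = g w"
  shows "higher_frechet f vs w = higher_frechet g vs w"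
  using assms(2)
proof (induction vs arbitrary: w)
  case (Cons v vs)
  have "(higher_frechet f vs has_derivative D) (at w) \<longleftrightarrow> (higher_frechet g vs has_derivative D) (at w)" for D
    using Cons assms(1) by (metis has_derivative_transform_within_open)
  then show ?case
    by (simp add: frechet_derivative_def)
qed (use assms(3) in simp)

lemma holomorphic_fun_on_higher_frechet:
  assumes "holomorphic_fun_on f S" "open S"
  shows "holomorphic_fun_on (higher_frechet f vs) S"
  using assms by (induction vs) (auto intro: holomorphic_fun_on_frechet_derivative)

lemma open_slice:
  assumes "open (S :: (complex ^ 'n) set)"
  shows "open {t. w + t *s v \<in> S}"
proof -
  have "continuous_on UNIV (\<lambda>t. w + t *s v)"
    by (intro continuous_intros)
  from open_vimage[OF assms this] show ?thesis
    by (simp add: vimage_def)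
qed

text \<open>The parameter \<open>t\<close> stays general because the induction step differentiates
  the identity and so needs it on a neighbourhood.\<close>

lemma higher_deriv_slice:
  assumes "holomorphic_fun_on f S" "open S" "w + t *s v \<in> S"
  shows "(deriv ^^ m) (\<lambda>t. f (w + t *s v)) t = higher_frechet f (replicate m v) (w + t *s v)"
  using assms(3)
proof (induction m arbitrary: t)
  case (Suc m)
  have "\<forall>\<^sub>F t in nhds t. t \<in> {t. w + t *s v \<in> S}"
    using Suc.prems open_slice[OF assms(2)] by (intro eventually_nhds_in_open) auto
  then have "\<forall>\<^sub>F t in nhds t. (deriv ^^ m) (\<lambda>t. f (w + t *s v)) t =
      higher_frechet f (replicate m v) (w + t *s v)"
    by eventually_elim (use Suc.IH in auto)
  then have "(deriv ^^ Suc m) (\<lambda>t. f (w + t *s v)) t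
      = deriv (\<lambda>t. higher_frechet f (replicate m v) (w + t *s v)) t"
    by (simp add: deriv_cong_ev)
  also have "\<dots> = higher_frechet f (replicate (Suc m) v) (w + t *s v)"
    using holomorphic_fun_on_slice[OF holomorphic_fun_on_higher_frechet[OF assms(1,2)] Suc.prems]
    by (simp add: DERIV_imp_deriv)
  finally show ?case .
qed simp

lemma holomorphic_on_slice:
  assumes "holomorphic_fun_on f S" "\<And>t. t \<in> T \<Longrightarrow> w + t *s v \<in> S"
  shows "(\<lambda>t. f (w + t *s v)) holomorphic_on T"
  unfolding holomorphic_on_def field_differentiable_def
  using holomorphic_fun_on_slice[OF assms(1)] assms(2) has_field_derivative_at_within by blast

lemma radial_has_derivative:
  fixes f :: "complex ^ 'n \<Rightarrow> complex"
  assumes "holomorphic_fun_on f S" "w \<in> S"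
  shows "((\<lambda>w. f w *s w) has_derivative
    (\<lambda>h. f w *s h + frechet_derivative f (at w) h *s w)) (at w)"
  using holomorphic_fun_on_has_derivative[OF assms] by (auto intro!: derivative_eq_intros)

text \<open>Leibniz's rule for \<open>f\<close> times the identity: the second factor is linear, so
  at most one derivative falls on it, in \<open>m\<close> possible ways.\<close>

lemma higher_frechet_radial:
  assumes "holomorphic_fun_on f S" "open S" "w \<in> S"
  shows "higher_frechet (\<lambda>w. f w *s w) (replicate m z) w =
    higher_frechet f (replicate m z) w *s w
      + (of_nat m * higher_frechet f (replicate (m - 1) z) w) *s z"
  using assms(3)
proof (induction m arbitrary: w)
  case (Suc m)
  let ?H = "\<lambda>m. higher_frechet f (replicate m z)"
  note H = holomorphic_fun_on_higher_frechet[OF assms(1,2)]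
  have "((\<lambda>w. ?H m w *s w + (of_nat m * ?H (m - 1) w) *s z) has_derivative
      (\<lambda>h. ?H m w *s h + frechet_derivative (?H m) (at w) h *s w +
         (of_nat m * frechet_derivative (?H (m - 1)) (at w) h) *s z)) (at w)"
    by (rule derivative_eq_intros radial_has_derivative[OF H Suc.prems]
        holomorphic_fun_on_has_derivative[OF H Suc.prems] refl | simp)+
  then have "((\<lambda>w. higher_frechet (\<lambda>w. f w *s w) (replicate m z) w) has_derivative
      (\<lambda>h. ?H m w *s h + frechet_derivative (?H m) (at w) h *s w +
         (of_nat m * frechet_derivative (?H (m - 1)) (at w) h) *s z)) (at w)"
    by (rule has_derivative_transform_within_open) (use assms(2) Suc in auto)
  from frechet_derivative_at[OF this, symmetric]
  have "higher_frechet (\<lambda>w. f w *s w) (replicate (Suc m) z) w =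
      ?H m w *s z + ?H (Suc m) w *s w + (of_nat m * frechet_derivative (?H (m - 1)) (at w) z) *s z"
    by simp
  \<comment> \<open>For m = 0 the truncated \<open>m - 1\<close> does no harm, as the factor
    \<open>of_nat m\<close> vanishes.\<close>
  moreover have "of_nat m * frechet_derivative (?H (m - 1)) (at w) z = of_nat m * ?H m w"
    by (cases m) auto
  ultimately have "higher_frechet (\<lambda>w. f w *s w) (replicate (Suc m) z) w =
      ?H m w *s z + ?H (Suc m) w *s w + (of_nat m * ?H m w) *s z"
    by (simp only:)
  also have "\<dots> = ?H (Suc m) w *s w + (of_nat (Suc m) * ?H (Suc m - 1) w) *s z"
    by (simp add: vec_eq_iff algebra_simps)
  finally show ?case .
qed simp

lemma higher_frechet_radial_0:
  assumes "holomorphic_fun_on f S" "open S" "0 \<in> S"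
  shows "higher_frechet (\<lambda>w. f w *s w) (replicate (Suc m) z) 0 =
    (of_nat (Suc m) * (deriv ^^ m) (\<lambda>t. f (t *s z)) 0) *s z"
  using higher_frechet_radial[OF assms, of "Suc m"] higher_deriv_slice[OF assms(1,2), of 0 0 z m]
    assms(3) by simp

text \<open>Comparison of power series; \<open>0 < k\<close> keeps \<open>c\<close> out of the
  coefficient considered.\<close>

lemma higher_deriv_gap_factor:
  assumes "h holomorphic_on ball 0 1" "\<And>z. z \<in> ball 0 1 \<Longrightarrow> f z = c + z ^ k * h z" "0 < k"
  shows "(deriv ^^ (k + n)) f 0 / fact (k + n) = (deriv ^^ n) h 0 / fact n"
proof -
  define H where "H = fps_expansion h 0"
  have "h has_fps_expansion H"
    unfolding H_def using assms(1) by (intro has_fps_expansion_fps_expansion[of "ball 0 1"]) auto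
  then have 1: "(\<lambda>z. c + z ^ k * h z) has_fps_expansion fps_const c + fps_X ^ k * H"
    by (intro fps_expansion_intros)
  have 2: "\<forall>\<^sub>F z in nhds 0. c + z ^ k * h z = f z"
  proof -
    have "\<forall>\<^sub>F z in nhds 0. z \<in> ball (0::complex) 1"
      by (intro eventually_nhds_in_open) auto
    then show ?thesis
      by eventually_elim (use assms(2) in auto)
  qed
  have "f has_fps_expansion fps_const c + fps_X ^ k * H"
    using has_fps_expansion_cong[OF 2 refl] 1 by simp
  from fps_nth_fps_expansion[OF this, of "k + n"] show ?thesis
    using assms(3) by (simp add: fps_X_power_mult_nth H_def fps_expansion_def)
qed

subsection \<open>Minkowski functionals and radial maps\<close>

lemma minkowski_functionalD:
  assumes "minkowski_functional \<rho> \<Omega>"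
  shows "continuous_on S \<rho>" and "\<rho> (t *s z) = cmod t * \<rho> z" and "\<rho> 0 = 0"
    and "z \<in> \<Omega> \<longleftrightarrow> \<rho> z < 1" and "z \<noteq> 0 \<Longrightarrow> 0 < \<rho> z"
proof -
  have "continuous_on UNIV \<rho>"
    using assms by (simp only: minkowski_functional_def)
  then show "continuous_on S \<rho>"
    by (rule continuous_on_subset) simp
  show "\<rho> (t *s z) = cmod t * \<rho> z" "\<rho> 0 = 0"
    using assms by (simp_all only: minkowski_functional_def)
  have "\<Omega> = {z. \<rho> z < 1}"
    using assms by (simp only: minkowski_functional_def)
  then show "z \<in> \<Omega> \<longleftrightarrow> \<rho> z < 1"
    by blast
  have "0 \<le> \<rho> z" "\<rho> z = 0 \<longleftrightarrow> z = 0"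
    using assms by (simp_all only: minkowski_functional_def)
  then show "0 < \<rho> z" if "z \<noteq> 0"
    using that by linarith
qed

lemma scalar_product_scale: "scalar_product u (c *s v) = c * scalar_product u (v :: complex ^ 'n)"
  by (simp add: scalar_product_def sum_distrib_left mult_ac)

text \<open>Euler's relation. With A the real derivative of \<rho> at z, twice the left side is A z
  - \<i> A(\<i> z), where A z = \<rho> z by real homogeneity and A(\<i> z) = 0 by rotation
  invariance.\<close>

lemma minkowski_wirtinger_mult:
  fixes \<rho> :: "complex ^ 'n \<Rightarrow> real"
  assumes \<rho>: "minkowski_functional \<rho> \<Omega>" and diff: "\<rho> differentiable (at z)"
  shows "scalar_product (wirtinger \<rho> z) z = \<rho> z / 2"
proof -
  obtain A where A: "(\<rho> has_derivative A) (at z)"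
    using diff by (auto simp: differentiable_def)
  then have lin: "linear A"
    using has_derivative_linear by blast
  note hom = minkowski_functionalD(2)[OF \<rho>]
  have line: "((\<lambda>t::real. \<rho> (z + t *\<^sub>R v)) has_field_derivative A v) (at 0)" for v
  proof -
    have "((\<lambda>t::real. z + t *\<^sub>R v) has_derivative (\<lambda>t. t *\<^sub>R v)) (at 0)"
      by (auto intro!: derivative_eq_intros)
    from has_derivative_compose[OF this, of \<rho> A] A
    have "((\<lambda>t::real. \<rho> (z + t *\<^sub>R v)) has_derivative (\<lambda>t. A (t *\<^sub>R v))) (at 0)"
      by simp
    then show ?thesis
      by (simp add: has_field_derivative_def linear_scale[OF lin] mult_commute_abs)
  qed
  have Az: "A z = \<rho> z"
  proof -
    have "((\<lambda>t::real. \<bar>1 + t\<bar> * \<rho> z) has_field_derivative A z) (at 0)"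
    proof -
      have "\<rho> (z + t *\<^sub>R z) = \<bar>1 + t\<bar> * \<rho> z" for t
      proof -
        have "z + t *\<^sub>R z = complex_of_real (1 + t) *s z"
          by (simp add: scaleR_eq_vector_scalar_mult vector_sadd_rdistrib del: of_real_add add: of_real_add)
        then show ?thesis
          by (simp only: hom norm_of_real)
      qed
      then show ?thesis
        using line[of z] by simp
    qed
    moreover have "((\<lambda>t::real. \<bar>1 + t\<bar> * \<rho> z) has_field_derivative \<rho> z) (at 0)"
      unfolding has_field_derivative_def
    proof (rule has_derivative_transform_within_open[where s = "{-1<..}"])
      show "((\<lambda>t::real. (1 + t) * \<rho> z) has_derivative (*) (\<rho> z)) (at 0)"
        by (auto intro!: derivative_eq_intros)
    qed auto
    ultimately show ?thesis
      using DERIV_unique by blast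
  qed
  \<comment> \<open>Along the tangent \<i> z to the rotation orbit, \<rho> is multiplied by sqrt (1
    + t^2), which has slope 0 at t = 0.\<close>
  have Aiz: "A (\<i> *s z) = 0"
  proof -
    have "((\<lambda>t::real. sqrt (1 + t\<^sup>2) * \<rho> z) has_field_derivative A (\<i> *s z)) (at 0)"
    proof -
      have "\<rho> (z + t *\<^sub>R (\<i> *s z)) = sqrt (1 + t\<^sup>2) * \<rho> z" for t
      proof -
        have "z + t *\<^sub>R (\<i> *s z) = Complex 1 t *s z"
          by (simp add: vec_eq_iff complex_eq_iff)
        then show ?thesis
          by (simp add: hom cmod_def)
      qed
      then show ?thesis
        using line[of "\<i> *s z"] by simp
    qed
    moreover have "((\<lambda>t::real. sqrt (1 + t\<^sup>2) * \<rho> z) has_field_derivative 0) (at 0)"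
      by (auto intro!: derivative_eq_intros)
    ultimately show ?thesis
      using DERIV_unique by blast
  qed
  define a b where "a = (\<lambda>j. A (axis j 1))" and "b = (\<lambda>j. A (axis j \<i>))"
  have A_eq: "A v = (\<Sum>j\<in>UNIV. Re (v $ j) * a j + Im (v $ j) * b j)" for v
  proof -
    have "v = (\<Sum>j\<in>UNIV. Re (v $ j) *\<^sub>R axis j 1 + Im (v $ j) *\<^sub>R axis j \<i>)"
      by (simp add: vec_eq_iff complex_eq_iff axis_def if_distrib if_distribR sum.If_cases cong: if_cong)
    then have "A v = A (\<Sum>j\<in>UNIV. Re (v $ j) *\<^sub>R axis j 1 + Im (v $ j) *\<^sub>R axis j \<i>)"
      by (rule arg_cong)
    then show ?thesis
      by (simp add: linear_sum[OF lin] linear_add[OF lin] linear_scale[OF lin] a_def b_def)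
  qed
  have wirt: "wirtinger \<rho> z $ j = (of_real (a j) - \<i> * of_real (b j)) / 2" for j
    using DERIV_imp_deriv[OF line] by (simp add: wirtinger_def a_def b_def)
  show ?thesis
  proof (rule complex_eqI)
    have "Re (scalar_product (wirtinger \<rho> z) z) = (\<Sum>j\<in>UNIV. (Re (z $ j) * a j + Im (z $ j) * b j) / 2)"
      unfolding scalar_product_def wirt Re_sum by (intro sum.cong) (auto simp: algebra_simps)
    then show "Re (scalar_product (wirtinger \<rho> z) z) = Re (\<rho> z / 2)"
      using A_eq[of z] Az by (simp flip: sum_divide_distrib)
    have "Im (scalar_product (wirtinger \<rho> z) z)
        = (\<Sum>j\<in>UNIV. - (Re ((\<i> *s z) $ j) * a j + Im ((\<i> *s z) $ j) * b j) / 2)"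
      unfolding scalar_product_def wirt Im_sum by (intro sum.cong) (auto simp: algebra_simps)
    also have "\<dots> = - A (\<i> *s z) / 2"
      unfolding A_eq[of "\<i> *s z"] by (simp only: sum_negf[symmetric] sum_divide_distrib)
    finally show "Im (scalar_product (wirtinger \<rho> z) z) = Im (\<rho> z / 2)"
      by (simp add: Aiz)
  qed
qed

text \<open>Along a real line through 0, \<rho> is |t| times a positive constant, whose one-sided
  slopes have opposite signs. Hence points where \<rho> is differentiable, in particular those off
  \<open>E\<close>, are nonzero.\<close>

lemma minkowski_not_differentiable_0:
  fixes \<rho> :: "complex ^ 'n \<Rightarrow> real"
  assumes \<rho>: "minkowski_functional \<rho> \<Omega>"
  shows "\<not> \<rho> differentiable (at 0)"
proof
  assume "\<rho> differentiable (at 0)"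
  then obtain A where A: "(\<rho> has_derivative A) (at 0)"
    by (auto simp: differentiable_def)
  define v :: "complex ^ 'n" where "v = 1"
  have "v \<noteq> 0" by (simp add: v_def)
  then have "\<rho> v > 0"
    by (rule minkowski_functionalD[OF \<rho>])
  have "\<rho> (t *\<^sub>R v) = \<bar>t\<bar> * \<rho> v" for t
    unfolding scaleR_eq_vector_scalar_mult minkowski_functionalD(2)[OF \<rho>] norm_of_real ..
  moreover have "((\<lambda>t::real. t *\<^sub>R v) has_derivative (\<lambda>t. t *\<^sub>R v)) (at 0)"
    by (auto intro!: derivative_eq_intros)
  ultimately have "((\<lambda>t::real. \<bar>t\<bar> * \<rho> v) has_derivative (\<lambda>t. A (t *\<^sub>R v))) (at 0)"
    using has_derivative_compose[of "\<lambda>t::real. t *\<^sub>R v" _ 0 UNIV \<rho> A] A by simp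
  then have "((\<lambda>t::real. \<bar>t\<bar> * \<rho> v) has_field_derivative A v) (at 0)"
    by (simp add: has_field_derivative_def mult_commute_abs
        linear_scale[OF has_derivative_linear[OF A]])
  then have lim: "((\<lambda>t::real. \<bar>t\<bar> * \<rho> v / t) \<longlongrightarrow> A v) (at 0)"
    by (simp add: DERIV_def)
  have "A v = \<rho> v"
    using lim by (intro tendsto_unique[OF _ tendsto_within_subset[OF lim, of "{0<..}"] tendsto_eventually])
      (auto simp: eventually_at_filter trivial_limit_at_right_real)
  moreover have "A v = - \<rho> v"
    using lim by (intro tendsto_unique[OF _ tendsto_within_subset[OF lim, of "{..<0}"] tendsto_eventually])
      (auto simp: eventually_at_filter trivial_limit_at_left_real)
  ultimately show False
    using \<open>\<rho> v > 0\<close> by simp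
qed

section \<open>Coefficients and Jacobian of radial maps\<close>

lemma C1_outside_imp_differentiable:
  "C1_outside \<rho> E \<Longrightarrow> z \<notin> E \<Longrightarrow> \<rho> differentiable (at z)"
  unfolding C1_outside_def differentiable_def by blast

text \<open>Euler's relation turns the pairing with z into \<rho>(z) / 2, which cancels the 2 and
  one power of \<rho>; the factor m + 1 from differentiating a radial map reduces (m + 1)! to
  m!.\<close>

lemma coeff_a_radial:
  fixes f :: "complex ^ 'n \<Rightarrow> complex"
  assumes "holomorphic_fun_on f \<Omega>" "open \<Omega>" "0 \<in> \<Omega>"
    and \<rho>: "minkowski_functional \<rho> \<Omega>" and "\<rho> differentiable (at z)" "\<rho> z \<noteq> 0"
  shows "coeff_a \<rho> (\<lambda>w. f w *s w) (Suc m) z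
    = (deriv ^^ m) (\<lambda>t. f (t *s z)) 0 / (fact m * of_real (\<rho> z) ^ m)"
proof -
  have "(of_nat (Suc m) :: complex) \<noteq> 0"
    by (rule of_nat_neq_0)
  then show ?thesis
    using assms(6)
    unfolding coeff_a_def higher_frechet_radial_0[OF assms(1-3)] scalar_product_scale
        minkowski_wirtinger_mult[OF \<rho> assms(5)]
    by (simp add: field_simps del: of_nat_Suc)
qed

lemma jacobian_radial_mult:
  fixes f :: "complex ^ 'n \<Rightarrow> complex"
  assumes "holomorphic_fun_on f S" "w \<in> S"
  shows "jacobian (\<lambda>w. f w *s w) w *v h = f w *s h + frechet_derivative f (at w) h *s w"
proof -
  note hd = radial_has_derivative[OF assms]
  have lin: "linear (frechet_derivative f (at w))"
    using holomorphic_fun_on_has_derivative[OF assms] has_derivative_linear by blast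
  have "Vector_Spaces.linear (*s) (*s) (\<lambda>h. f w *s h + frechet_derivative f (at w) h *s w)"
    by (rule clinear_mapI) (auto simp: linear_add[OF lin] vec_eq_iff algebra_simps
        holomorphic_fun_on_frechet_derivative_mult[OF assms])
  then show ?thesis
    unfolding jacobian_def frechet_derivative_at[OF hd, symmetric] by (rule matrix_works)
qed

text \<open>The point w is itself an eigenvector of the Jacobian with eigenvalue d, so invertibility
  forces d \<noteq> 0 and the inverse divides w by d.\<close>

lemma jacobian_radial_inverse:
  fixes f :: "complex ^ 'n \<Rightarrow> complex"
  assumes "holomorphic_fun_on f S" "w \<in> S" "invertible (jacobian (\<lambda>w. f w *s w) w)" "w \<noteq> 0"
  defines "d \<equiv> f w + frechet_derivative f (at w) w"
  shows "d \<noteq> 0" and "matrix_inv (jacobian (\<lambda>w. f w *s w) w) *v (f w *s w) = (f w / d) *s w"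
proof -
  let ?J = "jacobian (\<lambda>w. f w *s w) w"
  have J: "?J *v w = d *s w"
    by (simp add: jacobian_radial_mult[OF assms(1,2)] d_def vector_sadd_rdistrib)
  have "matrix_inv ?J ** ?J = mat 1"
    using someI_ex[OF assms(3)[unfolded invertible_def]] by (simp add: matrix_inv_def)
  then have inv: "matrix_inv ?J *v (?J *v v) = v" for v
    by (simp add: matrix_vector_mul_assoc)
  show "d \<noteq> 0"
    using inv[of w] assms(4) by (auto simp: J)
  have "d *s (matrix_inv ?J *v w) = w"
    using inv[of w] by (simp add: J vector_scalar_commute)
  then have "matrix_inv ?J *v w = (1 / d) *s w"
    using \<open>d \<noteq> 0\<close> by (metis (no_types, lifting) divide_self_if times_divide_eq_left mult_1 vector_smult_assoc vector_smult_lid)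
  then show "matrix_inv ?J *v (f w *s w) = (f w / d) *s w"
    by (simp add: vector_scalar_commute flip: vector_smult_assoc)
qed

text \<open>Here w is both base point and direction; expanding the direction in the standard basis
  reduces to fixed directions, where continuity is known.\<close>

lemma holomorphic_fun_on_continuous_radial_derivative:
  fixes f :: "complex ^ 'n \<Rightarrow> complex"
  assumes "holomorphic_fun_on f S" "open S"
  shows "continuous_on S (\<lambda>w. frechet_derivative f (at w) w)"
proof -
  have "frechet_derivative f (at w) w = (\<Sum>i\<in>UNIV. w $ i * frechet_derivative f (at w) (axis i 1))"
    if "w \<in> S" for w
  proof -
    have lin: "linear (frechet_derivative f (at w))"
      using holomorphic_fun_on_has_derivative[OF assms(1) that] has_derivative_linear by blast
    have "frechet_derivative f (at w) w
        = frechet_derivative f (at w) (\<Sum>i\<in>UNIV. w $ i *s axis i 1)"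
      by (simp only: basis_expansion)
    then show ?thesis
      by (simp add: linear_sum[OF lin] holomorphic_fun_on_frechet_derivative_mult[OF assms(1) that])
  qed
  moreover have "continuous_on S (\<lambda>w. \<Sum>i\<in>UNIV. w $ i * frechet_derivative f (at w) (axis i 1))"
    by (intro continuous_intros
        holomorphic_fun_on_continuous_on[OF holomorphic_fun_on_frechet_derivative[OF assms]])
  ultimately show ?thesis
    by (simp cong: continuous_on_cong)
qed

subsection \<open>The upper bound\<close>

text \<open>Off \<open>E\<close>, starlikeness and Euler's relation make the real part positive. The
  quotient is continuous on \<Omega> and the complement of \<open>E\<close> is dense, so the weak
  inequality holds on all of \<Omega>, also on slices contained in \<open>E\<close>.\<close>

lemma starlike_radial_Re_nonneg:
  fixes f :: "complex ^ 'n \<Rightarrow> complex"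
  assumes \<Omega>: "open \<Omega>" and \<rho>: "minkowski_functional \<rho> \<Omega>"
    and E: "closure (- E) = UNIV" "C1_outside \<rho> E"
    and f: "holomorphic_fun_on f \<Omega>" "f 0 \<noteq> 0"
    and F: "(\<lambda>w. f w *s w) \<in> starlike_maps \<Omega> \<rho> E"
    and w: "w \<in> \<Omega>"
  shows "f w + frechet_derivative f (at w) w \<noteq> 0"
    and "Re (f w / (f w + frechet_derivative f (at w) w)) \<ge> 0"
proof -
  define d where "d = (\<lambda>w. f w + frechet_derivative f (at w) w)"
  have inv: "invertible (jacobian (\<lambda>w. f w *s w) w)" if "w \<in> \<Omega>" for w
    using F that by (simp add: starlike_maps_def locally_biholomorphic_on_def)
  have d: "d w \<noteq> 0" if "w \<in> \<Omega>" for w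
  \<comment> \<open>At 0 the eigenvector argument is void; there \<open>d\<close> reduces to
    \<open>f 0\<close>.\<close>
  proof (cases "w = 0")
    case True
    then have "frechet_derivative f (at w) w = 0"
      using holomorphic_fun_on_frechet_derivative_mult[OF f(1) that, of 0 w] by simp
    then show ?thesis
      using f(2) True by (simp add: d_def)
  next
    case False
    then show ?thesis
      using jacobian_radial_inverse(1)[OF f(1) that inv[OF that]] by (simp add: d_def)
  qed
  then show "f w + frechet_derivative f (at w) w \<noteq> 0"
    using w by (simp add: d_def)
  have pos: "Re (f w / d w) > 0" if "w \<in> \<Omega>" "w \<notin> E" for w
  proof -
    have diff: "\<rho> differentiable (at w)"
      using C1_outside_imp_differentiable E(2) that(2) by blast
    then have "w \<noteq> 0"
      using minkowski_not_differentiable_0[OF \<rho>] by blast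
    then have "\<rho> w > 0"
      by (rule minkowski_functionalD[OF \<rho>])
    have "Re (scalar_product (wirtinger \<rho> w) (matrix_inv (jacobian (\<lambda>w. f w *s w) w) *v (f w *s w))) > 0"
      using F that by (simp add: starlike_maps_def)
    then have "Re ((f w / d w) * of_real (\<rho> w / 2)) > 0"
      unfolding jacobian_radial_inverse(2)[OF f(1) that(1) inv[OF that(1)] \<open>w \<noteq> 0\<close>]
        scalar_product_scale minkowski_wirtinger_mult[OF \<rho> diff] by (simp add: d_def)
    moreover have "Re (x * of_real r) = Re x * r" for x r
      by simp
    ultimately have "Re (f w / d w) * (\<rho> w / 2) > 0"
      by (simp only:)
    then show ?thesis
      using \<open>\<rho> w > 0\<close> by (simp only: zero_less_mult_iff) auto
  qed
  have cont: "continuous_on \<Omega> (\<lambda>w. Re (f w / d w))"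
    using d unfolding d_def by (intro continuous_intros holomorphic_fun_on_continuous_on[OF f(1)]
        holomorphic_fun_on_continuous_radial_derivative f(1) \<Omega>) auto
  show "Re (f w / (f w + frechet_derivative f (at w) w)) \<ge> 0"
  proof (rule ccontr)
    assume neg: "\<not> ?thesis"
    define U where "U = \<Omega> \<inter> (\<lambda>w. Re (f w / d w)) -` {..<0}"
    have "open U"
      unfolding U_def using cont \<Omega> by (intro continuous_open_preimage) auto
    moreover have "w \<in> U"
      using neg w by (simp add: U_def d_def)
    ultimately obtain u where "u \<in> U" "u \<notin> E"
      using E(1) by (metis ComplD UNIV_I closure_iff_nhds_not_empty disjoint_iff subset_refl)
    then show False
      using pos[of u] by (simp add: U_def)
  qed
qed

text \<open>F(z) - z is the radial map of f - 1, and its factor z absorbs one derivative: a zero of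
  order k + 1 there kills the slice derivatives of f - 1 of orders 0 to k - 1.\<close>

lemma zero_of_order_radial:
  fixes f :: "complex ^ 'n \<Rightarrow> complex"
  assumes f: "holomorphic_fun_on f \<Omega>" and \<Omega>: "open \<Omega>" "0 \<in> \<Omega>"
    and zero: "zero_of_order (\<lambda>z. f z *s z - z) (k + 1)" and "v \<noteq> 0" "n < k"
  shows "(deriv ^^ n) (\<lambda>t. f (t *s v) - 1) 0 = 0"
proof -
  have eq: "(\<lambda>z. f z *s z - z) = (\<lambda>z. (f z - 1) *s z)"
    by (simp add: vec_eq_iff algebra_simps fun_eq_iff)
  note rad = higher_frechet_radial_0[OF holomorphic_fun_on_diff_const[OF f, of 1] \<Omega>, of n v]
  have "higher_frechet_zero (\<lambda>z. (f z - 1) *s z) (Suc n) 0"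
    using zero \<open>n < k\<close> unfolding zero_of_order_def eq by simp
  then have "higher_frechet (\<lambda>z. (f z - 1) *s z) (replicate (Suc n) v) 0 = 0"
    unfolding higher_frechet_zero_def by (metis length_replicate)
  then show ?thesis
    unfolding rad using \<open>v \<noteq> 0\<close> by (simp del: of_nat_Suc)
qed

text \<open>Everything is pulled back to the unit disc along the complex line through z, where
  \<open>starlike_slice_bound\<close> applies.\<close>

lemma toeplitz_quantity_upper_bound:
  fixes f :: "complex ^ 'n \<Rightarrow> complex"
  assumes \<Omega>: "open \<Omega>" and \<rho>: "minkowski_functional \<rho> \<Omega>"
    and E: "closure (- E) = UNIV" "C1_outside \<rho> E"
    and k: "1 \<le> k" and adm: "admissible \<Omega> \<rho> E k f" and z: "z \<in> \<Omega> - E"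
  shows "k \<le> 3 \<Longrightarrow> toeplitz_quantity \<rho> (\<lambda>w. f w *s w) k z
            \<le> 1 + 8 / real k ^ 2 + (real k + 2) * (6 - real k) / real k ^ 4"
    and "k \<ge> 3 \<Longrightarrow> toeplitz_quantity \<rho> (\<lambda>w. f w *s w) k z
            \<le> 1 + 8 / real k ^ 2 + (2 + real k) / real k ^ 3"
proof -
  have f: "holomorphic_fun_on f \<Omega>" and F: "(\<lambda>w. f w *s w) \<in> starlike_maps \<Omega> \<rho> E"
    and zero: "zero_of_order (\<lambda>z. f z *s z - z) (k + 1)"
    using adm by (auto simp: admissible_def)
  note hom = minkowski_functionalD(2)[OF \<rho>] and mem = minkowski_functionalD(4)[OF \<rho>]
  have diff: "\<rho> differentiable (at z)"
    using C1_outside_imp_differentiable E(2) z by blast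
  then have "z \<noteq> 0"
    using minkowski_not_differentiable_0[OF \<rho>] by blast
  then have \<rho>z: "\<rho> z > 0"
    by (rule minkowski_functionalD[OF \<rho>])
  have "0 \<in> \<Omega>"
    using mem[of 0] hom[of 0 0] by simp
  \<comment> \<open>Normalised to \<rho> v = 1, so that the slice through \<open>v\<close> maps the
    unit disc into \<Omega>.\<close>
  define v where "v = complex_of_real (1 / \<rho> z) *s z"
  have \<rho>v: "\<rho> v = 1" and "v \<noteq> 0"
    using \<rho>z \<open>z \<noteq> 0\<close> by (auto simp: v_def hom norm_divide)
  have zv: "t *s z = (of_real (\<rho> z) * t) *s v" for t
    using \<rho>z by (simp add: v_def)
  have inD: "t *s v \<in> \<Omega>" if "t \<in> ball 0 1" for t
    using that by (simp add: mem hom \<rho>v)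
  define g where "g = (\<lambda>t. f (t *s v) - 1)"
  have G: "(\<lambda>t. f (t *s v)) holomorphic_on ball 0 1"
    using holomorphic_on_slice[OF f, of "ball 0 1" 0 v] inD by simp
  then have g: "g holomorphic_on ball 0 1"
    unfolding g_def by (intro holomorphic_intros)
  have g0: "(deriv ^^ n) g 0 = 0" if "n < k" for n
    unfolding g_def by (rule zero_of_order_radial[OF f \<Omega> \<open>0 \<in> \<Omega>\<close> zero \<open>v \<noteq> 0\<close> that])
  obtain A where A: "A holomorphic_on ball 0 1" and gA: "\<And>t. t \<in> ball 0 1 \<Longrightarrow> g t = g 0 + t ^ k * A t"
    using holomorphic_gap_factor[OF g, of k] g0 k by auto
  have "g 0 = 0"
    using g0[of 0] k by simp
  then have f0: "f 0 = 1"
    by (simp add: g_def)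
  have fA: "f (t *s v) = 1 + t ^ k * A t" if "t \<in> ball 0 1" for t
    using gA[OF that] \<open>g 0 = 0\<close> by (simp add: g_def)
  have derG: "deriv (\<lambda>t. 1 + t ^ k * A t) t = frechet_derivative f (at (t *s v)) v" if "t \<in> ball 0 1" for t
  proof -
    have "((\<lambda>t. f (t *s v)) has_field_derivative frechet_derivative f (at (t *s v)) v) (at t)"
      using holomorphic_fun_on_slice[OF f, of 0 t v] inD[OF that] by simp
    then have "((\<lambda>t. 1 + t ^ k * A t) has_field_derivative frechet_derivative f (at (t *s v)) v) (at t)"
      unfolding has_field_derivative_def
      by (rule has_derivative_transform_within_open[where s = "ball 0 1"]) (use that fA in auto)
    then show ?thesis
      by (rule DERIV_imp_deriv)
  qed
  have denom: "1 + t ^ k * A t + t * deriv (\<lambda>t. 1 + t ^ k * A t) t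
      = f (t *s v) + frechet_derivative f (at (t *s v)) (t *s v)" if "t \<in> ball 0 1" for t
    using that holomorphic_fun_on_frechet_derivative_mult[OF f inD[OF that]] by (simp add: derG fA)
  note star = starlike_radial_Re_nonneg[OF \<Omega> \<rho> E f _ F inD]
  \<comment> \<open>Passing from \<open>z\<close> to \<open>v\<close> scales the slice derivative of
    order k + n by \<rho>(z)^(k + n), the power left in the denominator of
    \<open>coeff_a\<close>.\<close>
  have coeff: "coeff_a \<rho> (\<lambda>w. f w *s w) (k + n + 1) z = (deriv ^^ n) A 0 / fact n" for n
  proof -
    have "(deriv ^^ (k + n)) (\<lambda>t. f (t *s z)) 0 = of_real (\<rho> z) ^ (k + n) * (deriv ^^ (k + n)) (\<lambda>t. f (t *s v)) 0"
    proof -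
      have "(deriv ^^ (k + n)) (\<lambda>t. f ((of_real (\<rho> z) * t) *s v)) 0
          = of_real (\<rho> z) ^ (k + n) * (deriv ^^ (k + n)) (\<lambda>t. f (t *s v)) (of_real (\<rho> z) * 0)"
        by (rule higher_deriv_compose_linear[OF G, of "ball 0 (1 / \<rho> z)"])
          (use \<rho>z in \<open>auto simp: norm_mult field_simps\<close>)
      moreover have "(\<lambda>t. f (t *s z)) = (\<lambda>t. f ((of_real (\<rho> z) * t) *s v))"
        by (simp only: zv)
      ultimately show ?thesis
        by (simp only: mult_zero_right)
    qed
    moreover have "(deriv ^^ (k + n)) (\<lambda>t. f (t *s v)) 0 / fact (k + n) = (deriv ^^ n) A 0 / fact n"
      using k fA by (intro higher_deriv_gap_factor[OF A]) auto
    ultimately show ?thesis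
      using coeff_a_radial[OF f \<Omega> \<open>0 \<in> \<Omega>\<close> \<rho> diff, of "k + n"] \<rho>z by simp
  qed
  have c1: "coeff_a \<rho> (\<lambda>w. f w *s w) (k + 1) z = A 0"
    using coeff[of 0] by simp
  have c2: "coeff_a \<rho> (\<lambda>w. f w *s w) (2 * k + 1) z = (deriv ^^ k) A 0 / fact k"
    using coeff[of k] by (simp only: mult_2)
  note bound = starlike_slice_bound[OF k A _ _ refl refl]
  moreover have "\<And>t. t \<in> ball 0 1 \<Longrightarrow> 1 + t ^ k * A t + t * deriv (\<lambda>t. 1 + t ^ k * A t) t \<noteq> 0"
    using star(1) f0 denom by simp
  moreover have "\<And>t. t \<in> ball 0 1 \<Longrightarrow>
      Re ((1 + t ^ k * A t) / (1 + t ^ k * A t + t * deriv (\<lambda>t. 1 + t ^ k * A t) t)) \<ge> 0"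
    using star(2) f0 denom fA by simp
  ultimately show "k \<le> 3 \<Longrightarrow> toeplitz_quantity \<rho> (\<lambda>w. f w *s w) k z
            \<le> 1 + 8 / real k ^ 2 + (real k + 2) * (6 - real k) / real k ^ 4"
    and "k \<ge> 3 \<Longrightarrow> toeplitz_quantity \<rho> (\<lambda>w. f w *s w) k z
            \<le> 1 + 8 / real k ^ 2 + (2 + real k) / real k ^ 3"
    unfolding toeplitz_quantity_def c1 c2 Let_def by blast+
qed

subsection \<open>The extremal map\<close>

text \<open>Multiplied by the variable, this is a rotated \<open>k\<close>-fold symmetric Koebe
  function. The principal power is holomorphic on the disc, where the base has positive real
  part.\<close>

definition extremal :: "nat \<Rightarrow> complex \<Rightarrow> complex" where
  "extremal k \<zeta> = (1 - \<i> * \<zeta> ^ k) powr (- 2 / of_nat k)"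

text \<open>Numerator and denominator have positive real part, which keeps principal powers off the
  branch cut; the real part of the quotient is (1 - |u|^2) / |1 + \<i> u|^2.\<close>

lemma one_minus_ii_mult:
  assumes "norm (u :: complex) < 1"
  shows "1 - \<i> * u \<notin> \<real>\<^sub>\<le>\<^sub>0" "1 - \<i> * u \<noteq> 0" "1 + \<i> * u \<noteq> 0" "Re ((1 - \<i> * u) / (1 + \<i> * u)) > 0"
proof -
  have "\<bar>Im u\<bar> < 1"
    using abs_Im_le_cmod[of u] assms by linarith
  then have pos: "Re (1 - \<i> * u) > 0" "Re (1 + \<i> * u) > 0"
    by auto
  then show "1 - \<i> * u \<notin> \<real>\<^sub>\<le>\<^sub>0"
    by (simp add: complex_nonpos_Reals_iff)
  show "1 - \<i> * u \<noteq> 0" and ne: "1 + \<i> * u \<noteq> 0"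
    using pos by (metis less_irrefl zero_complex.sel(1))+
  have "Re ((1 - \<i> * u) * cnj (1 + \<i> * u)) = 1 - (norm u)\<^sup>2"
    unfolding cmod_power2 by (simp add: power2_eq_square algebra_simps)
  moreover have "(norm u)\<^sup>2 < 1"
    using assms by (simp add: abs_square_less_1)
  ultimately have "Re ((1 - \<i> * u) * cnj (1 + \<i> * u)) > 0"
    by simp
  moreover have "(1 - \<i> * u) / (1 + \<i> * u)
      = (1 - \<i> * u) * cnj (1 + \<i> * u) / of_real ((norm (1 + \<i> * u))\<^sup>2)"
    by (rule complex_div_cnj[unfolded])
  ultimately show "Re ((1 - \<i> * u) / (1 + \<i> * u)) > 0"
    using ne by (simp only: Re_divide_of_real) (intro divide_pos_pos; simp)
qed

lemma norm_power_less_1: "norm (\<zeta> :: complex) < 1 \<Longrightarrow> 0 < k \<Longrightarrow> norm (\<zeta> ^ k) < 1"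
  by (simp add: norm_power power_less_one_iff)

lemma extremal_nonzero:
  assumes "norm \<zeta> < 1" "0 < k"
  shows "extremal k \<zeta> \<noteq> 0"
  using one_minus_ii_mult(2)[OF norm_power_less_1[OF assms]] by (simp add: extremal_def)

lemma extremal_has_field_derivative:
  assumes "norm \<zeta> < 1" "0 < k"
  shows "(extremal k has_field_derivative 2 * \<i> * \<zeta> ^ (k - 1) * extremal k \<zeta> / (1 - \<i> * \<zeta> ^ k)) (at \<zeta>)"
proof -
  note ne = one_minus_ii_mult[OF norm_power_less_1[OF assms]]
  have "((\<lambda>\<zeta>. (1 - \<i> * \<zeta> ^ k) powr (- 2 / of_nat k)) has_field_derivative
      (- 2 / of_nat k) * (1 - \<i> * \<zeta> ^ k) powr (- 2 / of_nat k - 1) * (- (\<i> * (of_nat k * \<zeta> ^ (k - 1))))) (at \<zeta>)"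
    using ne by (auto intro!: derivative_eq_intros)
  moreover have "(- 2 / of_nat k) * (1 - \<i> * \<zeta> ^ k) powr (- 2 / of_nat k - 1) * (- (\<i> * (of_nat k * \<zeta> ^ (k - 1))))
      = 2 * \<i> * \<zeta> ^ (k - 1) * extremal k \<zeta> / (1 - \<i> * \<zeta> ^ k)"
    using ne assms(2) by (simp add: extremal_def powr_diff)
  ultimately show ?thesis
    unfolding extremal_def[abs_def] by simp
qed

lemma extremal_holomorphic: "0 < k \<Longrightarrow> extremal k holomorphic_on ball 0 1"
  unfolding holomorphic_on_def field_differentiable_def
  using extremal_has_field_derivative[THEN has_field_derivative_at_within, of _ k] by fastforce

text \<open>Logarithmic differentiation shows that the sum is \<open>extremal k \<zeta>\<close>
  times (1 + \<i> \<zeta>^k) / (1 - \<i> \<zeta>^k), a Cayley transform whose reciprocal has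
  positive real part.\<close>

lemma extremal_log_derivative:
  assumes "norm \<zeta> < 1" "0 < k"
  shows "extremal k \<zeta> + \<zeta> * deriv (extremal k) \<zeta> \<noteq> 0"
    and "Re (extremal k \<zeta> / (extremal k \<zeta> + \<zeta> * deriv (extremal k) \<zeta>)) > 0"
proof -
  note ne = one_minus_ii_mult[OF norm_power_less_1[OF assms]]
  have "\<zeta> * \<zeta> ^ (k - 1) = \<zeta> ^ k"
    using assms(2) by (simp flip: power_Suc)
  then have dz: "\<zeta> * deriv (extremal k) \<zeta> = 2 * \<i> * \<zeta> ^ k * extremal k \<zeta> / (1 - \<i> * \<zeta> ^ k)"
    unfolding DERIV_imp_deriv[OF extremal_has_field_derivative[OF assms]]
    by (metis (no_types, opaque_lifting) mult.assoc mult.left_commute times_divide_eq_right)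
  have eq: "extremal k \<zeta> + \<zeta> * deriv (extremal k) \<zeta> 
      = extremal k \<zeta> * ((1 + \<i> * \<zeta> ^ k) / (1 - \<i> * \<zeta> ^ k))"
    unfolding dz using ne by (simp add: field_simps)
  show "extremal k \<zeta> + \<zeta> * deriv (extremal k) \<zeta> \<noteq> 0"
    unfolding eq using ne extremal_nonzero[OF assms] by simp
  show "Re (extremal k \<zeta> / (extremal k \<zeta> + \<zeta> * deriv (extremal k) \<zeta>)) > 0"
    unfolding eq using ne extremal_nonzero[OF assms] by simp
qed

text \<open>The binomial expansion of (1 - \<i> u)^s, s = -2 / k, up to second order: its
  coefficients are -\<i> s and -s (s - 1) / 2. Then u = \<zeta>^k is substituted.\<close>

lemma extremal_expansion:
  assumes k: "0 < k"
  obtains A where "A holomorphic_on ball 0 1"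
    "\<And>\<zeta>. \<zeta> \<in> ball 0 1 \<Longrightarrow> extremal k \<zeta> = 1 + \<zeta> ^ k * A \<zeta>"
    "A 0 = 2 * \<i> / of_nat k" "(deriv ^^ k) A 0 / fact k = - (of_nat k + 2) / (of_nat k)\<^sup>2"
proof -
  define s :: complex where "s = - 2 / of_nat k"
  define H where "H = (\<lambda>u. (1 - \<i> * u) powr s)"
  have H1: "((\<lambda>u. (1 - \<i> * u) powr s) has_field_derivative - \<i> * s * (1 - \<i> * u) powr (s - 1)) (at u)"
    if "u \<in> ball 0 1" for u s
    using one_minus_ii_mult(1)[of u] that by (auto intro!: derivative_eq_intros)
  have H: "H holomorphic_on ball 0 1"
    unfolding holomorphic_on_def field_differentiable_def H_def
    using H1 has_field_derivative_at_within by blast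
  have "deriv H 0 = - \<i> * s"
    unfolding H_def using DERIV_imp_deriv[OF H1[of 0]] by simp
  have "(deriv ^^ 2) H 0 = deriv (\<lambda>u. - \<i> * s * (1 - \<i> * u) powr (s - 1)) 0"
  proof -
    have "\<forall>\<^sub>F u in nhds 0. u \<in> ball (0::complex) 1"
      by (intro eventually_nhds_in_open) auto
    then have "\<forall>\<^sub>F u in nhds 0. deriv H u = - \<i> * s * (1 - \<i> * u) powr (s - 1)"
      by eventually_elim (use H1 in \<open>auto simp: H_def intro!: DERIV_imp_deriv\<close>)
    then show ?thesis
      by (simp add: numeral_2_eq_2 deriv_cong_ev)
  qed
  also have "\<dots> = - s * (s - 1)"
  proof -
    have "((\<lambda>u. - \<i> * s * (1 - \<i> * u) powr (s - 1)) has_field_derivative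
      - \<i> * s * (- \<i> * (s - 1) * (1 - \<i> * 0) powr (s - 1 - 1))) (at 0)"
      by (intro DERIV_cmult H1) simp
    from DERIV_imp_deriv[OF this] show ?thesis
      by (simp add: algebra_simps)
  qed
  finally have H2: "(deriv ^^ 2) H 0 = - s * (s - 1)" .
  obtain B where B: "B holomorphic_on ball 0 1" "\<And>u. u \<in> ball 0 1 \<Longrightarrow> H u = H 0 + u ^ 1 * B u"
    using holomorphic_gap_factor[OF H, of 1] by auto
  obtain C where C: "C holomorphic_on ball 0 1" "\<And>u. u \<in> ball 0 1 \<Longrightarrow> B u = B 0 + u ^ 1 * C u"
    using holomorphic_gap_factor[OF B(1), of 1] by auto
  have B0: "B 0 = - \<i> * s"
    using higher_deriv_gap_factor[OF B, of 0] \<open>deriv H 0 = - \<i> * s\<close> by simp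
  have "C 0 = (deriv ^^ 1) B 0 / fact 1"
    using higher_deriv_gap_factor[OF C, of 0] by simp
  also have "\<dots> = (deriv ^^ 2) H 0 / fact 2"
    using higher_deriv_gap_factor[OF B, of 1] by (simp add: numeral_2_eq_2)
  finally have C0: "C 0 = - s * (s - 1) / 2"
    unfolding H2 by simp
  have pow: "\<zeta> ^ k \<in> ball 0 1" if "\<zeta> \<in> ball 0 1" for \<zeta> :: complex
    using norm_power_less_1[OF _ k, of \<zeta>] that by simp
  have hol: "(\<lambda>\<zeta>. h (\<zeta> ^ k)) holomorphic_on ball 0 1" if "h holomorphic_on ball 0 1" for h
  proof -
    have "(\<lambda>\<zeta>. \<zeta> ^ k) holomorphic_on ball (0::complex) 1"
      by (intro holomorphic_intros)
    from holomorphic_on_compose_gen[OF this that] pow show ?thesis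
      by (auto simp: o_def image_subset_iff)
  qed
  show thesis
  proof (rule that)
    show "(\<lambda>\<zeta>. B (\<zeta> ^ k)) holomorphic_on ball 0 1"
      using hol B by blast
    show "extremal k \<zeta> = 1 + \<zeta> ^ k * B (\<zeta> ^ k)" if "\<zeta> \<in> ball 0 1" for \<zeta>
      using B(2)[OF pow[OF that]] by (simp add: extremal_def H_def s_def)
    show "B (0 ^ k) = 2 * \<i> / of_nat k"
      using k by (simp add: B0 s_def power_0_left)
    \<comment> \<open>The coefficient of order k of B(\<zeta>^k) is the first-order coefficient of
      B, which is \<open>C 0\<close>.\<close>
    have "B (\<zeta> ^ k) = B 0 + \<zeta> ^ k * C (\<zeta> ^ k)" if "\<zeta> \<in> ball 0 1" for \<zeta>
      using C(2)[OF pow[OF that]] by simp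
    from higher_deriv_gap_factor[OF hol[OF C(1)] this k, of 0]
    have "(deriv ^^ k) (\<lambda>\<zeta>. B (\<zeta> ^ k)) 0 / fact k = C 0"
      using k by (simp add: power_0_left)
    also have "C 0 = - (of_nat k + 2) / (of_nat k)\<^sup>2"
      using k by (simp add: C0 s_def field_simps power2_eq_square)
    finally show "(deriv ^^ k) (\<lambda>\<zeta>. B (\<zeta> ^ k)) 0 / fact k = - (of_nat k + 2) / (of_nat k)\<^sup>2" .
  qed
qed

lemma vector_expand_axis: "c *s v = (\<Sum>i\<in>UNIV. (c * v $ i) *s axis i 1)" for v :: "complex ^ 'n"
  using basis_expansion[of "c *s v"] by simp

text \<open>Maps of the shape below are closed under directional derivatives, each of which lowers the
  exponents by one.\<close>

lemma higher_frechet_radial_power: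
  fixes L :: "complex ^ 'n \<Rightarrow> complex"
  assumes L: "bounded_linear L" and D: "open D" and a: "a holomorphic_on D" and "length vs \<le> m"
  shows "\<exists>a' b. a' holomorphic_on D \<and> (\<forall>i. b i holomorphic_on D) \<and>
    (\<forall>w. L w \<in> D \<longrightarrow> higher_frechet (\<lambda>w. (L w ^ m * a (L w)) *s w) vs w =
      (L w ^ (m - length vs) * a' (L w)) *s w
        + (\<Sum>i\<in>UNIV. (L w ^ Suc (m - length vs) * b i (L w)) *s axis i 1))"
  using assms(4)
proof (induction vs)
  case Nil
  then show ?case
    using a by (intro exI[of _ a] exI[of _ "\<lambda>i z. 0"]) auto
next
  case (Cons v vs)
  define F where "F = (\<lambda>w. (L w ^ m * a (L w)) *s w)"
  define p where "p = m - Suc (length vs)"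
  have p: "m - length vs = Suc p" "m - length (v # vs) = p"
    using Cons.prems by (auto simp: p_def)
  obtain a' b where a': "a' holomorphic_on D" and b: "\<And>i. b i holomorphic_on D"
    and eq: "\<And>w. L w \<in> D \<Longrightarrow> higher_frechet F vs w = (L w ^ Suc p * a' (L w)) *s w
        + (\<Sum>i\<in>UNIV. (L w ^ Suc (Suc p) * b i (L w)) *s axis i 1)"
    using Cons unfolding p F_def by auto
  \<comment> \<open>\<open>T q c\<close> is what remains of the derivative of z^(q + 1) c(z) once
    the factor z^q is taken out.\<close>
  define T where "T = (\<lambda>q c (z::complex). of_nat (Suc q) * c z + z * deriv c z)"
  have T: "T q c holomorphic_on D" if "c holomorphic_on D" for q c
    unfolding T_def using that D by (intro holomorphic_intros) auto
  have der: "((\<lambda>w. L w ^ Suc q * c (L w)) has_derivative (\<lambda>h. (L w ^ q * T q c (L w)) * L h)) (at w)"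
    if "c holomorphic_on D" "L w \<in> D" for q c w
  proof -
    have "(c has_field_derivative deriv c (L w)) (at (L w))"
      using that D holomorphic_derivI by blast
    from DERIV_mult[OF DERIV_power[OF DERIV_ident, of "Suc q"] this]
    have "((\<lambda>z. z ^ Suc q * c z) has_field_derivative L w ^ q * T q c (L w)) (at (L w))"
      by (simp add: T_def algebra_simps)
    from has_derivative_compose[OF bounded_linear_imp_has_derivative[OF L] this[unfolded has_field_derivative_def]]
    show ?thesis .
  qed
  have deriv_eq: "frechet_derivative (higher_frechet F vs) (at w) v =
      (L w ^ p * (T p a' (L w) * L v)) *s w
        + (\<Sum>i\<in>UNIV. (L w ^ Suc p * (a' (L w) * v $ i + T (Suc p) (b i) (L w) * L v)) *s axis i 1)"
    if w: "L w \<in> D" for w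
  proof -
    have "((\<lambda>w. (L w ^ Suc p * a' (L w)) *s w
        + (\<Sum>i\<in>UNIV. (L w ^ Suc (Suc p) * b i (L w)) *s axis i 1)) has_derivative
      (\<lambda>h. (L w ^ Suc p * a' (L w)) *s h + ((L w ^ p * T p a' (L w)) * L h) *s w
        + (\<Sum>i\<in>UNIV. ((L w ^ Suc p * T (Suc p) (b i) (L w)) * L h) *s axis i 1))) (at w)"
    proof (intro has_derivative_add has_derivative_sum)
      show "((\<lambda>w. (L w ^ Suc p * a' (L w)) *s w) has_derivative
        (\<lambda>h. (L w ^ Suc p * a' (L w)) *s h + ((L w ^ p * T p a' (L w)) * L h) *s w)) (at w)"
        by (rule has_derivative_vector_scalar_mult[OF der[OF a' w] has_derivative_ident])
      show "((\<lambda>w. (L w ^ Suc (Suc p) * b i (L w)) *s axis i 1) has_derivative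
        (\<lambda>h. ((L w ^ Suc p * T (Suc p) (b i) (L w)) * L h) *s axis i 1)) (at w)" for i
        using has_derivative_vector_scalar_mult[OF der[OF b w, where q = "Suc p"]
            has_derivative_const[of "axis i 1"]]
        by (simp del: power_Suc)
    qed
    moreover have "open (L -` D)"
      using D L by (intro open_vimage) (auto intro: linear_continuous_on)
    ultimately have "(higher_frechet F vs has_derivative
      (\<lambda>h. (L w ^ Suc p * a' (L w)) *s h + ((L w ^ p * T p a' (L w)) * L h) *s w
        + (\<Sum>i\<in>UNIV. ((L w ^ Suc p * T (Suc p) (b i) (L w)) * L h) *s axis i 1))) (at w)"
      by (rule has_derivative_transform_within_open) (use eq w in auto)
    from frechet_derivative_at[OF this, symmetric]
    have "frechet_derivative (higher_frechet F vs) (at w) v = (L w ^ Suc p * a' (L w)) *s v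
        + ((L w ^ p * T p a' (L w)) * L v) *s w
        + (\<Sum>i\<in>UNIV. ((L w ^ Suc p * T (Suc p) (b i) (L w)) * L v) *s axis i 1)"
      by simp
    \<comment> \<open>Differentiating the factor w leaves the constant vector v; expanded in the
      basis, it is absorbed into the sum, whose power of L is one higher.\<close>
    then show ?thesis
      unfolding vector_expand_axis[of _ v]
      by (simp only: distrib_left vector_sadd_rdistrib sum.distrib mult.assoc add_ac)
  qed
  have hol: "(\<lambda>z. T p a' z * L v) holomorphic_on D"
    "(\<lambda>z. a' z * v $ i + T (Suc p) (b i) z * L v) holomorphic_on D" for i
    by (intro holomorphic_intros T a' b)+
  show ?case
    unfolding p F_def[symmetric] higher_frechet.simps
    by (rule exI[of _ "\<lambda>z. T p a' z * L v"],
        rule exI[of _ "\<lambda>i z. a' z * v $ i + T (Suc p) (b i) z * L v"],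
        intro conjI allI impI, rule hol, rule hol, erule deriv_eq)
qed

text \<open>\<rho> is not assumed convex, so the functional comes from compactness: a coordinate
  divided by the maximum of its quotient with \<rho> on the unit sphere. Homogeneity extends the
  bound to all vectors.\<close>

lemma minkowski_dominated_functional:
  fixes \<rho> :: "complex ^ 'n \<Rightarrow> real"
  assumes \<rho>: "minkowski_functional \<rho> \<Omega>"
  obtains L z where "bounded_linear L" "\<And>c w. L (c *s w) = c * L w"
    "\<And>w. cmod (L w) \<le> \<rho> w" "z \<in> \<Omega>" "L z = of_real (\<rho> z)" "z \<noteq> 0"
proof -
  note hom = minkowski_functionalD(2)[OF \<rho>]
  note pos = minkowski_functionalD(5)[OF \<rho>]
  \<comment> \<open>Any fixed coordinate serves; \<open>undefined\<close> merely names one.\<close>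
  define j :: 'n where "j = undefined"
  define q where "q = (\<lambda>w. cmod (w $ j) / \<rho> w)"
  have q_scale: "q (c *s w) = q w" if "c \<noteq> 0" for c w
    using that by (simp add: q_def hom norm_mult)
  have "continuous_on (sphere 0 1) q"
    unfolding q_def
  proof (intro continuous_intros)
    show "continuous_on (sphere 0 1) \<rho>"
      by (rule minkowski_functionalD[OF \<rho>])
    show "\<forall>w\<in>sphere 0 1. \<rho> w \<noteq> 0"
    proof
      fix w :: "complex ^ 'n" assume "w \<in> sphere 0 1"
      then have "w \<noteq> 0"
        by auto
      then show "\<rho> w \<noteq> 0"
        using pos[of w] by simp
    qed
  qed
  moreover have axis: "axis j (1::complex) \<in> sphere 0 1"
    by (simp add: norm_Basis axis_in_Basis_iff Basis_complex_def)
  ultimately obtain s where s: "s \<in> sphere 0 1" "\<And>w. w \<in> sphere 0 1 \<Longrightarrow> q w \<le> q s"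
    using continuous_attains_sup[of "sphere (0 :: complex ^ 'n) 1" q] compact_sphere by blast
  have "0 < q (axis j 1)"
    using pos[of "axis j 1"] by (simp add: q_def axis_eq_0_iff)
  then have qs: "q s > 0"
    using s(2)[OF axis] by simp
  have "s \<noteq> 0"
    using s(1) by auto
  define L where "L = (\<lambda>w. w $ j / complex_of_real (q s))"
  have L_scale: "L (c *s w) = c * L w" for c w
    by (simp add: L_def)
  have L_le: "cmod (L w) \<le> \<rho> w" for w
  proof (cases "w = 0")
    case False
    have "q ((1 / of_real (norm w)) *s w) \<le> q s"
      using False by (intro s(2)) (simp add: norm_vector_scalar_mult norm_divide)
    then have "q w \<le> q s"
      using False q_scale by simp
    then have "q w * \<rho> w \<le> \<rho> w * q s"
      using pos[OF False] by (simp add: mult.commute)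
    moreover have "cmod (w $ j) = q w * \<rho> w"
      using pos[OF False] by (simp add: q_def)
    ultimately show ?thesis
      using qs by (simp add: L_def norm_divide divide_le_eq)
  qed (simp add: L_def minkowski_functionalD(3)[OF \<rho>])
  have "cmod (s $ j) = q s * \<rho> s"
    using pos[OF \<open>s \<noteq> 0\<close>] by (simp add: q_def)
  then have "cmod (L s) = \<rho> s"
    using qs by (simp add: L_def norm_divide)
  \<comment> \<open>The maximiser \<open>s\<close> is rotated so that L becomes positive, and scaled
    to \<rho> z = 1/2, inside \<Omega>.\<close>
  define z where "z = (cnj (L s) / of_real (2 * (\<rho> s)\<^sup>2)) *s s"
  have \<rho>z: "\<rho> z = 1 / 2"
    using pos[OF \<open>s \<noteq> 0\<close>] \<open>cmod (L s) = \<rho> s\<close>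
    by (simp add: z_def hom norm_divide norm_mult norm_power power2_eq_square)
  moreover have "L z = of_real (\<rho> z)"
  proof -
    have "L s * cnj (L s) = of_real ((\<rho> s)\<^sup>2)"
      unfolding \<open>cmod (L s) = \<rho> s\<close>[symmetric] by (rule complex_norm_square[symmetric])
    then have "L z = 1 / 2"
      using pos[OF \<open>s \<noteq> 0\<close>] by (simp add: z_def L_scale mult.commute field_simps)
    then show ?thesis
      by (simp add: \<rho>z)
  qed
  moreover have "bounded_linear L"
    unfolding L_def by (intro bounded_linear_divide[THEN bounded_linear_compose] bounded_linear_vec_nth)
  moreover have "z \<in> \<Omega>"
    using \<open>\<rho> z = 1 / 2\<close> by (simp add: minkowski_functionalD(4)[OF \<rho>])
  moreover have "z \<noteq> 0"
    using \<open>\<rho> z = 1 / 2\<close> minkowski_functionalD(3)[OF \<rho>] by auto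
  ultimately show thesis
    using L_scale L_le that[of L z] by blast
qed

section \<open>The extremal radial map built from a dominated functional\<close>

context
  fixes \<Omega> E :: "(complex ^ 'n) set" and \<rho> :: "complex ^ 'n \<Rightarrow> real"
    and L :: "complex ^ 'n \<Rightarrow> complex" and k :: nat
  assumes \<Omega>: "open \<Omega>" and \<rho>: "minkowski_functional \<rho> \<Omega>" and E: "C1_outside \<rho> E"
    and L: "bounded_linear L" "\<And>c w. L (c *s w) = c * L w" "\<And>w. cmod (L w) \<le> \<rho> w"
    and k: "0 < k"
begin

lemma functional_in_disc: "w \<in> \<Omega> \<Longrightarrow> cmod (L w) < 1"
  using L(3)[of w] minkowski_functionalD(4)[OF \<rho>] by fastforce

lemma extremal_comp_has_derivative:
  assumes "w \<in> \<Omega>"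
  shows "((\<lambda>w. extremal k (L w)) has_derivative (\<lambda>h. deriv (extremal k) (L w) * L h)) (at w)"
proof -
  have "(extremal k has_field_derivative deriv (extremal k) (L w)) (at (L w))"
    using extremal_holomorphic[OF k] functional_in_disc[OF assms]
    by (intro holomorphic_derivI[of _ "ball 0 1"]) auto
  from has_derivative_compose[OF bounded_linear_imp_has_derivative[OF L(1)]
      this[unfolded has_field_derivative_def]]
  show ?thesis .
qed

lemma extremal_comp_holomorphic: "holomorphic_fun_on (\<lambda>w. extremal k (L w)) \<Omega>"
  unfolding holomorphic_fun_on_def
proof
  fix w assume "w \<in> \<Omega>"
  moreover have "Vector_Spaces.linear (*s) (*) (\<lambda>h. deriv (extremal k) (L w) * L h)"
    by (rule clinear_funI) (auto simp: L(2) bounded_linear.linear[OF L(1), THEN linear_add] algebra_simps)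
  ultimately show "\<exists>A. ((\<lambda>w. extremal k (L w)) has_derivative A) (at w) \<and> Vector_Spaces.linear (*s) (*) A"
    using extremal_comp_has_derivative by blast
qed

lemma zero_in_domain: "0 \<in> \<Omega>"
  by (simp add: minkowski_functionalD(3,4)[OF \<rho>])

lemma functional_0: "L 0 = 0"
  using linear_0 bounded_linear.linear[OF L(1)] by blast

lemma extremal_radial_starlike: "(\<lambda>w. extremal k (L w) *s w) \<in> starlike_maps \<Omega> \<rho> E"
proof -
  let ?f = "\<lambda>w. extremal k (L w)"
  let ?F = "\<lambda>w. ?f w *s w"
  note f = extremal_comp_holomorphic
  have fd: "frechet_derivative ?f (at w) h = deriv (extremal k) (L w) * L h" if "w \<in> \<Omega>" for w h
    using frechet_derivative_at[OF extremal_comp_has_derivative[OF that], symmetric] by simp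
  have d: "?f w + frechet_derivative ?f (at w) w = extremal k (L w) + L w * deriv (extremal k) (L w)"
    if "w \<in> \<Omega>" for w
    by (simp add: fd[OF that])
  have inv: "invertible (jacobian ?F w)" if w: "w \<in> \<Omega>" for w
  proof -
    \<comment> \<open>A kernel vector must be a multiple of w, and on w the Jacobian acts as
      multiplication by a nonzero number.\<close>
    have "v = 0" if v: "jacobian ?F w *v v = 0" for v
    proof -
      have f0: "?f w \<noteq> 0"
        using extremal_nonzero functional_in_disc[OF w] k by blast
      define s where "s = - frechet_derivative ?f (at w) v / ?f w"
      have "?f w *s v + frechet_derivative ?f (at w) v *s w = 0"
        using v jacobian_radial_mult[OF f w, of v] by simp
      then have "?f w *s v = (?f w * s) *s w"
        using f0 by (simp add: s_def add_eq_0_iff)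
      then have v_eq: "v = s *s w"
        using f0 by (simp add: vec_eq_iff)
      have "(s * (?f w + frechet_derivative ?f (at w) w)) *s w = 0"
        using v jacobian_radial_mult[OF f w, of v]
          holomorphic_fun_on_frechet_derivative_mult[OF f w, of s w]
        by (simp add: v_eq distrib_left vector_sadd_rdistrib mult.commute)
      then show "v = 0"
        using extremal_log_derivative(1)[OF functional_in_disc[OF w] k] d[OF w] v_eq by auto
    qed
    then show ?thesis
      by (simp add: invertible_left_inverse matrix_left_invertible_ker)
  qed
  have "holomorphic_map_on ?F \<Omega>"
    unfolding holomorphic_map_on_def
  proof
    fix w assume w: "w \<in> \<Omega>"
    have "Vector_Spaces.linear (*s) (*s) ((*v) (jacobian ?F w))"
      by (rule matrix_vector_mul_linear_gen)
    then show "\<exists>A. (?F has_derivative A) (at w) \<and> Vector_Spaces.linear (*s) (*s) A"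
      using radial_has_derivative[OF f w] jacobian_radial_mult[OF f w] by (metis (no_types, lifting) ext)
  qed
  moreover have "normalized ?F"
    unfolding normalized_def matrix_eq
    using jacobian_radial_mult[OF f zero_in_domain] k
    by (simp add: functional_0 extremal_def power_0_left)
  moreover have "Re (scalar_product (wirtinger \<rho> w) (matrix_inv (jacobian ?F w) *v ?F w)) > 0"
    if w: "w \<in> \<Omega>" "w \<notin> E" for w
  proof -
    have diff: "\<rho> differentiable (at w)"
      using C1_outside_imp_differentiable E w(2) by blast
    then have "w \<noteq> 0"
      using minkowski_not_differentiable_0[OF \<rho>] by blast
    then have "\<rho> w > 0"
      by (rule minkowski_functionalD[OF \<rho>])
    have "scalar_product (wirtinger \<rho> w) (matrix_inv (jacobian ?F w) *v ?F w)
        = ?f w / (?f w + frechet_derivative ?f (at w) w) * of_real (\<rho> w / 2)"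
      unfolding jacobian_radial_inverse(2)[OF f w(1) inv[OF w(1)] \<open>w \<noteq> 0\<close>]
        scalar_product_scale minkowski_wirtinger_mult[OF \<rho> diff] by simp
    moreover have "Re (x * of_real r) = Re x * r" for x r
      by simp
    ultimately show ?thesis
      using extremal_log_derivative(2)[OF functional_in_disc[OF w(1)] k] \<open>\<rho> w > 0\<close>
      unfolding d[OF w(1)] by (metis half_gt_zero mult_pos_pos)
  qed
  ultimately show ?thesis
    using inv by (simp add: starlike_maps_def locally_biholomorphic_on_def)
qed

lemma extremal_slice_deriv:
  assumes "z \<in> \<Omega>"
  shows "(deriv ^^ n) (\<lambda>t. extremal k (L (t *s z))) 0 = L z ^ n * (deriv ^^ n) (extremal k) 0"
proof -
  have "(deriv ^^ n) (\<lambda>t. extremal k (L z * t)) 0 = L z ^ n * (deriv ^^ n) (extremal k) (L z * 0)"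
  proof (rule higher_deriv_compose_linear[OF extremal_holomorphic[OF k], of "ball 0 1"])
    fix t :: complex assume "t \<in> ball 0 1"
    then have "cmod t * cmod (L z) \<le> 1 * cmod (L z)"
      by (intro mult_right_mono) auto
    then show "L z * t \<in> ball 0 1"
      using functional_in_disc[OF assms] by (simp add: norm_mult mult.commute)
  qed auto
  then show ?thesis
    by (simp add: L(2) mult.commute)
qed

lemma extremal_higher_deriv:
  "(deriv ^^ k) (extremal k) 0 / fact k = 2 * \<i> / of_nat k"
  "(deriv ^^ (2 * k)) (extremal k) 0 / fact (2 * k) = - (of_nat k + 2) / (of_nat k)\<^sup>2"
proof -
  obtain A where A: "A holomorphic_on ball 0 1"
    "\<And>\<zeta>. \<zeta> \<in> ball 0 1 \<Longrightarrow> extremal k \<zeta> = 1 + \<zeta> ^ k * A \<zeta>"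
    "A 0 = 2 * \<i> / of_nat k" "(deriv ^^ k) A 0 / fact k = - (of_nat k + 2) / (of_nat k)\<^sup>2"
    using extremal_expansion[OF k] by blast
  show "(deriv ^^ k) (extremal k) 0 / fact k = 2 * \<i> / of_nat k"
    using higher_deriv_gap_factor[OF A(1,2) k, of 0] A(3) by simp
  show "(deriv ^^ (2 * k)) (extremal k) 0 / fact (2 * k) = - (of_nat k + 2) / (of_nat k)\<^sup>2"
    using higher_deriv_gap_factor[OF A(1,2) k, of k] A(4) by (simp only: mult_2)
qed

lemma extremal_coeff_a:
  assumes z: "z \<in> \<Omega> - E"
  shows "coeff_a \<rho> (\<lambda>w. extremal k (L w) *s w) (Suc n) z
    = (deriv ^^ n) (extremal k) 0 / fact n * (L z / of_real (\<rho> z)) ^ n"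
proof -
  have diff: "\<rho> differentiable (at z)"
    using C1_outside_imp_differentiable E z by blast
  then have "z \<noteq> 0"
    using minkowski_not_differentiable_0[OF \<rho>] by blast
  then have "\<rho> z \<noteq> 0"
    using minkowski_functionalD(5)[OF \<rho>] by force
  from coeff_a_radial[OF extremal_comp_holomorphic \<Omega> zero_in_domain \<rho> diff this, of n]
  show ?thesis
    using extremal_slice_deriv[of z n] z by (simp add: power_divide mult_ac)
qed

text \<open>The value depends on z only through L z / \<rho> z, an expression continuous on \<Omega>
  away from 0, even across \<open>E\<close>.\<close>

lemma extremal_toeplitz_quantity:
  assumes z: "z \<in> \<Omega> - E"
  defines "x \<equiv> (L z / of_real (\<rho> z)) ^ k"
  shows "toeplitz_quantity \<rho> (\<lambda>w. extremal k (L w) *s w) k z =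
    (let a = - (of_nat k + 2) / (of_nat k)\<^sup>2 * x\<^sup>2; b = 2 * \<i> / of_nat k * x
     in cmod (1 - a\<^sup>2 - 2 * b\<^sup>2 + 2 * b\<^sup>2 * a))"
proof -
  have b: "coeff_a \<rho> (\<lambda>w. extremal k (L w) *s w) (k + 1) z = 2 * \<i> / of_nat k * x"
    using extremal_coeff_a[OF z, of k] unfolding extremal_higher_deriv x_def by simp
  have a: "coeff_a \<rho> (\<lambda>w. extremal k (L w) *s w) (2 * k + 1) z = - (of_nat k + 2) / (of_nat k)\<^sup>2 * x\<^sup>2"
    using extremal_coeff_a[OF z, of "2 * k"] unfolding extremal_higher_deriv x_def
    by (simp flip: power_mult add: mult.commute)
  show ?thesis
    unfolding toeplitz_quantity_def a b ..
qed

text \<open>The order is exact: in the direction z the derivative of order k + 1 is a nonzero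
  multiple of L(z)^k z, while lower orders vanish for all lists of directions by the closed form of
  \<open>higher_frechet_radial_power\<close>.\<close>

lemma extremal_zero_of_order:
  assumes z: "z \<in> \<Omega>" "L z \<noteq> 0"
  shows "zero_of_order (\<lambda>w. extremal k (L w) *s w - w) (k + 1)"
proof -
  have eq: "(\<lambda>w. extremal k (L w) *s w - w) = (\<lambda>w. (extremal k (L w) - 1) *s w)"
    by (simp add: vec_eq_iff algebra_simps fun_eq_iff)
  obtain A where A: "A holomorphic_on ball 0 1"
    "\<And>\<zeta>. \<zeta> \<in> ball 0 1 \<Longrightarrow> extremal k \<zeta> = 1 + \<zeta> ^ k * A \<zeta>"
    using extremal_expansion[OF k] by blast
  have "z \<noteq> 0"
    using z(2) functional_0 by auto
  have "holomorphic_fun_on (\<lambda>w. extremal k (L w) - 1) \<Omega>"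
    by (rule holomorphic_fun_on_diff_const[OF extremal_comp_holomorphic])
  from higher_frechet_radial_0[OF this \<Omega> zero_in_domain, of k z]
  have "higher_frechet (\<lambda>w. (extremal k (L w) - 1) *s w) (replicate (Suc k) z) 0 =
      (of_nat (Suc k) * (deriv ^^ k) (\<lambda>t. extremal k (L (t *s z)) - 1) 0) *s z" .
  also have "(deriv ^^ k) (\<lambda>t. extremal k (L (t *s z)) - 1) 0
      = (deriv ^^ k) (\<lambda>t. extremal k (L (t *s z))) 0 - (deriv ^^ k) (\<lambda>t. 1) 0"
  proof (rule higher_deriv_diff)
    show "(\<lambda>t. extremal k (L (t *s z))) holomorphic_on {t. 0 + t *s z \<in> \<Omega>}"
      using holomorphic_on_slice[OF extremal_comp_holomorphic, of "{t. 0 + t *s z \<in> \<Omega>}" 0 z] by simp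
  qed (use open_slice[OF \<Omega>, of 0 z] zero_in_domain in auto)
  also have "\<dots> = L z ^ k * (fact k * (2 * \<i> / of_nat k))"
    using extremal_higher_deriv(1) k extremal_slice_deriv[OF z(1), of k] by (simp add: field_simps)
  finally have ne: "higher_frechet (\<lambda>w. (extremal k (L w) - 1) *s w) (replicate (Suc k) z) 0 \<noteq> 0"
    using z(2) k \<open>z \<noteq> 0\<close> by (simp del: of_nat_Suc)
  have zero: "higher_frechet (\<lambda>w. (extremal k (L w) - 1) *s w) vs 0 = 0" if "length vs \<le> k" for vs
  proof -
    have 0: "L 0 \<in> ball 0 1"
      by (simp add: functional_0)
    \<comment> \<open>In the closed form at 0, the first term has the factor w and the others a
      positive power of L w.\<close>
    have "higher_frechet (\<lambda>w. (L w ^ k * A (L w)) *s w) vs 0 = 0"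
      using higher_frechet_radial_power[OF L(1) open_ball A(1) that] 0 by (fastforce simp: functional_0)
    moreover have "higher_frechet (\<lambda>w. (extremal k (L w) - 1) *s w) vs w
        = higher_frechet (\<lambda>w. (L w ^ k * A (L w)) *s w) vs w" if "w \<in> \<Omega>" for w
      using \<Omega> that
    proof (rule higher_frechet_cong_open)
      show "(extremal k (L w) - 1) *s w = (L w ^ k * A (L w)) *s w" if "w \<in> \<Omega>" for w
        using A(2)[of "L w"] functional_in_disc[OF that] by simp
    qed
    ultimately show ?thesis
      using zero_in_domain by simp
  qed
  show ?thesis
    unfolding zero_of_order_def eq higher_frechet_zero_def
    using zero ne by (auto intro!: exI[of _ "replicate (Suc k) z"] simp del: higher_frechet.simps replicate_Suc)
qed

end

theorem theorem9:
  fixes \<Omega> E :: "(complex ^ 'n) set" and \<rho> :: "complex ^ 'n \<Rightarrow> real"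
  assumes "bounded_starlike_circular_domain \<Omega>"
    and "0 \<in> \<Omega>"
    and "minkowski_functional \<rho> \<Omega>"
    and "consists_of_lower_dim_manifolds E"
    and "C1_outside \<rho> E"
  shows "(\<forall>k f. k \<ge> 1 \<longrightarrow> admissible \<Omega> \<rho> E k f \<longrightarrow>
            (\<forall>z\<in>\<Omega> - E.
               (k \<le> 3 \<longrightarrow> toeplitz_quantity \<rho> (\<lambda>w. f w *s w) k z
                  \<le> 1 + 8 / real k ^ 2 + (real k + 2) * (6 - real k) / real k ^ 4) \<and>
               (k \<ge> 3 \<longrightarrow> toeplitz_quantity \<rho> (\<lambda>w. f w *s w) k z
                  \<le> 1 + 8 / real k ^ 2 + (2 + real k) / real k ^ 3)))
       \<and> (\<forall>k\<in>{1, 2, 3}. \<forall>c::real.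
            (\<forall>f. admissible \<Omega> \<rho> E k f \<longrightarrow>
               (\<forall>z\<in>\<Omega> - E. toeplitz_quantity \<rho> (\<lambda>w. f w *s w) k z \<le> c)) \<longrightarrow>
            1 + 8 / real k ^ 2 + (real k + 2) * (6 - real k) / real k ^ 4 \<le> c)"
proof -
  note \<rho> = assms(3) and C1 = assms(5)
  have \<Omega>: "open \<Omega>"
    using assms(1) by (simp add: bounded_starlike_circular_domain_def)
  have E: "closure (- E) = UNIV"
    by (rule lower_dim_manifolds_dense_Compl[OF assms(4)])

  obtain L z0 where L: "bounded_linear L" "\<And>c w. L (c *s w) = c * L w" "\<And>w. cmod (L w) \<le> \<rho> w"
    and z0: "z0 \<in> \<Omega>" "L z0 = of_real (\<rho> z0)" "z0 \<noteq> 0"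
    using minkowski_dominated_functional[OF \<rho>] by metis
  have sharp: "1 + 8 / real k ^ 2 + (real k + 2) * (6 - real k) / real k ^ 4 \<le> c"
    if k: "k \<in> {1, 2, 3}" and c: "\<And>f z. admissible \<Omega> \<rho> E k f \<Longrightarrow> z \<in> \<Omega> - E \<Longrightarrow>
        toeplitz_quantity \<rho> (\<lambda>w. f w *s w) k z \<le> c" for k c
  proof (rule ccontr)
    assume less: "\<not> ?thesis"
    have k0: "0 < k"
      using k by auto
    have "\<rho> z0 \<noteq> 0"
      using minkowski_functionalD(5)[OF \<rho> z0(3)] by simp
    have adm: "admissible \<Omega> \<rho> E k (\<lambda>w. extremal k (L w))"
      unfolding admissible_def
      using extremal_comp_holomorphic[OF \<Omega> \<rho> C1 L k0] extremal_radial_starlike[OF \<Omega> \<rho> C1 L k0]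
        extremal_zero_of_order[OF \<Omega> \<rho> C1 L k0 z0(1)] z0(2) \<open>\<rho> z0 \<noteq> 0\<close> by simp
    \<comment> \<open>Unlike the quantity itself, this expression in L z / \<rho> z makes sense at
      \<open>z0\<close> even if \<open>z0\<close> lies in \<open>E\<close>.\<close>
    define \<Phi> :: "complex \<Rightarrow> real" where "\<Phi> = (\<lambda>x. let a = - (of_nat k + 2) / (of_nat k)\<^sup>2 * (x ^ k)\<^sup>2;
        b = 2 * \<i> / of_nat k * x ^ k in cmod (1 - a\<^sup>2 - 2 * b\<^sup>2 + 2 * b\<^sup>2 * a))"
    \<comment> \<open>Here b^2 = -4 / k^2, a = -(k + 2) / k^2 and a - 2 b^2 = (6 - k) / k^2, so the
      terms 1, -2 b^2 and -a (a - 2 b^2) are all positive and nothing cancels.\<close>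
    have "\<Phi> 1 = 1 + 8 / real k ^ 2 + (real k + 2) * (6 - real k) / real k ^ 4"
      using k by (auto simp: \<Phi>_def Let_def power2_eq_square norm_divide field_simps)
    then have "\<Phi> (L z0 / of_real (\<rho> z0)) > c"
      using less z0(2) \<open>\<rho> z0 \<noteq> 0\<close> by simp
    \<comment> \<open>By continuity the value exceeds c on a neighbourhood of \<open>z0\<close>,
      which contains points off \<open>E\<close>; 0 is removed because of the division by
      \<rho>.\<close>
    define U where "U = (\<Omega> - {0}) \<inter> (\<lambda>z. \<Phi> (L z / of_real (\<rho> z))) -` {c<..}"
    have "continuous_on (\<Omega> - {0}) (\<lambda>z. \<Phi> (L z / of_real (\<rho> z)))"
      unfolding \<Phi>_def Let_def
      using minkowski_functionalD(5)[OF \<rho>]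
      by (intro continuous_intros linear_continuous_on[OF L(1)] minkowski_functionalD(1)[OF \<rho>]) force+
    then have "open U"
      unfolding U_def using \<Omega> by (intro continuous_open_preimage) auto
    moreover have "z0 \<in> U"
      using \<open>\<Phi> (L z0 / of_real (\<rho> z0)) > c\<close> z0 by (simp add: U_def)
    ultimately obtain z where z: "z \<in> U" "z \<notin> E"
      using E by (metis ComplD UNIV_I closure_iff_nhds_not_empty disjoint_iff subset_refl)
    then have "\<Phi> (L z / of_real (\<rho> z)) \<le> c"
      using c[OF adm, of z] extremal_toeplitz_quantity[OF \<Omega> \<rho> C1 L k0, of z]
      by (simp add: U_def \<Phi>_def)
    then show False
      using z(1) by (simp add: U_def)
  qed
  show ?thesis
  proof (intro conjI allI impI ballI)
    fix k f z
    assume "1 \<le> k" "admissible \<Omega> \<rho> E k f" "z \<in> \<Omega> - E"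
    note upper = toeplitz_quantity_upper_bound[OF \<Omega> \<rho> E C1 this]
    show "toeplitz_quantity \<rho> (\<lambda>w. f w *s w) k z
        \<le> 1 + 8 / real k ^ 2 + (real k + 2) * (6 - real k) / real k ^ 4" if "k \<le> 3"
      using that by (rule upper)
    show "toeplitz_quantity \<rho> (\<lambda>w. f w *s w) k z
        \<le> 1 + 8 / real k ^ 2 + (2 + real k) / real k ^ 3" if "3 \<le> k"
      using that by (rule upper)
  next
    fix k and c :: real
    assume "k \<in> {1, 2, 3}" and "\<forall>f. admissible \<Omega> \<rho> E k f \<longrightarrow>
        (\<forall>z\<in>\<Omega> - E. toeplitz_quantity \<rho> (\<lambda>w. f w *s w) k z \<le> c)"
    then show "1 + 8 / real k ^ 2 + (real k + 2) * (6 - real k) / real k ^ 4 \<le> c"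
      by (intro sharp) blast+
  qed
qed

end
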